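(* Let $\sigma$ and $\tau$ be types of an integer $n\ge 1$. The coefficient of $h^\otimes_\tau$ in the $h^\otimes$-expansion of $H_\sigma$ is $\sum_T \mathrm{psgn}(T)$, where the sum is over all bounded polywrapping block tabloids $T$ of shape $\sigma$ and content $\tau$.
   Context: **Types.** A composition is a finite (possibly empty) list $\beta$ of positive integers, with $\mathrm{area}(\beta)$ the sum of its entries and $\ell(\beta)$ its length. A partition is a weakly decreasing composition; $\mathrm{sort}(\beta)$ is the partition obtained by sorting $\beta$. An ordered type of $n$ is a sequence $\delta=(\delta|_1,\delta|_2,\ldots)$ of compositions with $\sum_i i\,\mathrm{area}(\delta|_i)=n$, written $\delta=1^{\delta|_1}2^{\delta|_2}\cdots$. A type is an ordered type with all $\delta|_i$ partitions, and $\mathrm{psort}(\delta)$ is the type obtained by replacing each $\delta|_i$ by $\mathrm{sort}(\delta|_i)$. A block $d^r$ ($d,r\ge1$) is the ordered type with $\delta|_d=(r)$ and all other $\delta|_i$ empty. A type $\tau$ is identified with the multiset of its blocks (one copy of $d^r$ for each part $r$ of $\tau|_d$), and we list its blocks as $d_1^{r_1}\cdots d_k^{r_k}$. An $r$-ordered type is an ordered type $\delta$ with $\mathrm{area}(\delta|_i)$ divisible by $r$ for all $i$; $\mathrm{OTyp}_r(n)$ is the set of $r$-ordered types of $n$. **Polysymmetric functions.** Let $x_{ij}$ ($i,j\ge1$) be commuting indeterminates with $\deg x_{ij}=i$. $\mathrm{PSym}$ is the $\mathbb{Q}$-algebra of bounded-degree formal power series in the $x_{ij}$ invariant under swapping $x_{ij}$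 and $x_{ik}$ for all $i,j,k$; $\mathrm{PSym}(n)$ is its degree $n$ part. For an ordered type $\delta$, $h^\otimes_\delta=\prod_i h_{\delta|_i}(x_{i1},x_{i2},\ldots)$ where $h_\beta=\prod_j h_{\beta_j}$; $\{h^\otimes_\tau\}$ over types $\tau$ of $n$ is a basis of $\mathrm{PSym}(n)$, and the $h^\otimes$-expansion is the expansion in this basis. $H_d$ is the sum of all monomials of degree $d$ in the $x_{ij}$; $H_{d^r}$ is obtained from $H_d$ by replacing each $x_{ij}$ by $x_{ij}^r$; $H_\sigma=\prod_{i=1}^kH_{d_i^{r_i}}$ for $\sigma=d_1^{r_1}\cdots d_k^{r_k}$. **The function $\hat{s}_r$.** For an $r$-tuple $w=(w_0,\ldots,w_{r-1})$ of non-negative integers, let $v_i$ be the remainder of $w_i+i$ upon division by $r$; $\hat{s}_r(w)=(-1)^{\#\{i<j:\,v_i>v_j\}}$ if the $v_i$ are distinct, and $0$ otherwise. For a composition $\beta$ with $\ell(\beta)\le r$, $\hat{s}_r(\beta)=\sum_w\hat{s}_r(w)$ over all $r$-tuples $w$ of non-negative integers that become $\beta$ on deleting zeros; if $\ell(\beta)>r$, $\hat{s}_r(\beta)=0$. For an ordered type $\delta$, $\hat{s}_r(\delta)=\prod_i\hat{s}_r(\delta|_i)$. **Wrappings and polywrappings.** View the block $d^r$ as an array of boxes with $d$ rows and $r$ columns. For $k\mid d$, divide the rows from top to bottom into $d/k$ "$k$-sheets" of $k$ consecutive rows; list the $dr/k$ columns of $k$-sheets in reading order (first sheet left to right, then second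 sheet left to right, etc.). For a composition $\beta=(\beta_1,\ldots,\beta_l)$ of $dr/k$, the $k$-wrapping of $d^r$ of content $\beta$ is the set partition $(B_1,\ldots,B_l)$ of the boxes where $B_1$ is the first $\beta_1$ sheet-columns, $B_2$ the next $\beta_2$, etc.; the $B_j$ are called rectangles of height $k$. Given $\delta\in\mathrm{OTyp}_r(dr)$, the polywrapping $D$ of $d^r$ of ordered content $\mathrm{pocon}(D)=\delta$ is obtained by dividing the $d$ rows, from top to bottom for $k=1,2,\ldots$, into consecutive groups of $k\,\mathrm{area}(\delta|_k)/r$ rows, and putting on the $k$th group the $k$-wrapping $D_k$ of content $\delta|_k$. Set $\mathrm{psgn}(D)=\hat{s}_r(\delta)$. $D$ is $r$-bounded if it has at most $r$ rectangles of each height, i.e. $\ell(\delta|_k)\le r$ for all $k$. **Bounded polywrapping block tabloids.** A bounded polywrapping block tabloid $T$ of shape $\sigma=d_1^{r_1}\cdots d_k^{r_k}$ and content $\tau$ is a list $(D^{(1)},\ldots,D^{(k)})$ where $D^{(i)}$ is an $r_i$-bounded polywrapping of $d_i^{r_i}$ and the multiset union of the blocks of $\mathrm{psort}(\mathrm{pocon}(D^{(i)}))$, $1\le i\le k$, equals $\tau$. Set $\mathrm{psgn}(T)=\prod_{i=1}^k\mathrm{psgn}(D^{(i)})$, i.e. $\prod_i\hat{s}_{r_i}(\mathrm{pocon}(D^{(i)}))$. *)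

theory Defs
  imports Complex_Main "HOL-Library.Multiset"
begin

text \<open>
  Formal power series over the rationals in arbitrarily many commuting variables.  A monomial is
  the multiset of its variables, so that \<open>+\<close> on multisets multiplies monomials.
\<close>

typedef 'v mfps = "UNIV :: ('v multiset \<Rightarrow> rat) set"
  morphisms mcoeff Abs_mfps by simp

setup_lifting type_definition_mfps

lemma mfps_eqI: "(\<And>m. mcoeff f m = mcoeff g m) \<Longrightarrow> f = g"
  by (simp add: mcoeff_inject[symmetric] fun_eq_iff)

lemma finite_submultisets: "finite {a. a \<subseteq># (m :: 'v multiset)}"
proof (induction m)
  case empty
  then show ?case by simp
next
  case (add x m)
  have "{a. a \<subseteq># add_mset x m} \<subseteq> {a. a \<subseteq># m} \<union> add_mset x ` {a. a \<subseteq># m}"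
  proof
    fix a assume a: "a \<in> {a. a \<subseteq># add_mset x m}"
    show "a \<in> {a. a \<subseteq># m} \<union> add_mset x ` {a. a \<subseteq># m}"
    proof (cases "x \<in># a")
      case True
      then obtain b where b: "a = add_mset x b" by (meson mset_add)
      with a show ?thesis by auto
    next
      case False
      with a have "a \<subseteq># m"
        by (metis diff_subset_eq_self insert_DiffM2 mem_Collect_eq minus_add_mset_if_not_in_lhs
            subset_eq_diff_conv add_mset_add_single diff_single_trivial)
      then show ?thesis by simp
    qed
  qed
  with add show ?case by (meson finite_UnI finite_imageI finite_subset)
qed

lemma finite_msplit: "finite {(a, b). a + b = (m :: 'v multiset)}"
proof (rule finite_subset)
  show "{(a, b). a + b = m} \<subseteq> {a. a \<subseteq># m} \<times> {a. a \<subseteq># m}" by auto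
  show "finite ({a. a \<subseteq># m} \<times> {a. a \<subseteq># m})" by (simp add: finite_submultisets)
qed

instantiation mfps :: (type) comm_ring_1
begin

lift_definition zero_mfps :: "'v mfps" is "\<lambda>m. 0" .
lift_definition one_mfps :: "'v mfps" is "\<lambda>m. if m = {#} then 1 else 0" .
lift_definition plus_mfps :: "'v mfps \<Rightarrow> 'v mfps \<Rightarrow> 'v mfps" is "\<lambda>f g m. f m + g m" .
lift_definition minus_mfps :: "'v mfps \<Rightarrow> 'v mfps \<Rightarrow> 'v mfps" is "\<lambda>f g m. f m - g m" .
lift_definition uminus_mfps :: "'v mfps \<Rightarrow> 'v mfps" is "\<lambda>f m. - f m" .
lift_definition times_mfps :: "'v mfps \<Rightarrow> 'v mfps \<Rightarrow> 'v mfps"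
  is "\<lambda>f g m. \<Sum>(a, b)\<in>{(a, b). a + b = m}. f a * g b" .

instance
proof
  fix f g h :: "'v mfps"
  show "f + g + h = f + (g + h)" by transfer (simp add: add.assoc)
  show "f + g = g + f" by transfer (simp add: add.commute)
  show "0 + f = f" by transfer simp
  show "- f + f = 0" by transfer simp
  show "f - g = f + - g" by transfer simp
  show "(0 :: 'v mfps) \<noteq> 1" by transfer (metis zero_neq_one)
  show "f * g = g * f"
  proof (transfer, rule ext)
    fix f g :: "'v multiset \<Rightarrow> rat" and m :: "'v multiset"
    show "(\<Sum>(a, b)\<in>{(a, b). a + b = m}. f a * g b) = (\<Sum>(a, b)\<in>{(a, b). a + b = m}. g a * f b)"
      by (rule sum.reindex_bij_witness[where i = prod.swap and j = prod.swap])
         (auto simp: add.commute)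
  qed
  show "(f + g) * h = f * h + g * h"
    by transfer (simp add: distrib_right sum.distrib case_prod_unfold)
  show "1 * f = f"
  proof (transfer, rule ext)
    fix f :: "'v multiset \<Rightarrow> rat" and m :: "'v multiset"
    have "(\<Sum>(a, b)\<in>{(a, b). a + b = m}. (if a = {#} then 1 else 0 :: rat) * f b)
        = (\<Sum>(a, b)\<in>{({#} :: 'v multiset, m)}. (if a = {#} then 1 else 0 :: rat) * f b)"
      by (rule sum.mono_neutral_right) (auto simp: finite_msplit split: if_splits)
    then show "(\<Sum>(a, b)\<in>{(a, b). a + b = m}. (if a = {#} then 1 else 0 :: rat) * f b) = f m" by simp
  qed
  show "f * g * h = f * (g * h)"
  proof (transfer, rule ext)
    fix f g h :: "'v multiset \<Rightarrow> rat" and m :: "'v multiset"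
    let ?S = "\<lambda>m :: 'v multiset. {(a, b). a + b = m}"
    have "(\<Sum>(a, b)\<in>?S m. (\<Sum>(c, d)\<in>?S a. f c * g d) * h b)
        = (\<Sum>(p, q)\<in>Sigma (?S m) (\<lambda>p. ?S (fst p)). f (fst q) * g (snd q) * h (snd p))"
      by (subst sum.Sigma[symmetric])
         (auto simp: finite_msplit[unfolded case_prod_unfold] sum_distrib_right case_prod_unfold)
    also have "\<dots> = (\<Sum>(p, q)\<in>Sigma (?S m) (\<lambda>p. ?S (snd p)). f (fst p) * (g (fst q) * h (snd q)))"
      by (rule sum.reindex_bij_witness
          [where i = "\<lambda>(p, q). ((fst p + fst q, snd q), (fst p, fst q))"
             and j = "\<lambda>(p, q). ((fst q, snd q + snd p), (snd q, snd p))"])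
         (auto simp: add.assoc mult.assoc)
    also have "\<dots> = (\<Sum>(a, b)\<in>?S m. f a * (\<Sum>(c, d)\<in>?S b. g c * h d))"
      by (subst sum.Sigma[symmetric])
         (auto simp: finite_msplit[unfolded case_prod_unfold] sum_distrib_left case_prod_unfold)
    finally show "(\<Sum>(a, b)\<in>?S m. (\<Sum>(c, d)\<in>?S a. f c * g d) * h b)
        = (\<Sum>(a, b)\<in>?S m. f a * (\<Sum>(c, d)\<in>?S b. g c * h d))" .
  qed
qed

end

lift_definition mfps_scale :: "rat \<Rightarrow> 'v mfps \<Rightarrow> 'v mfps" is "\<lambda>c f m. c * f m" .

global_interpretation mfps: vector_space mfps_scale
  by unfold_locales (transfer, simp add: fun_eq_iff algebra_simps)+

text \<open>The substitution replacing every variable \<open>x\<close> by \<open>x ^ r\<close>; meaningful for \<open>r \<ge> 1\<close>.\<close>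

lift_definition power_vars :: "nat \<Rightarrow> 'v mfps \<Rightarrow> 'v mfps"
  is "\<lambda>r f m. \<Sum>m' | repeat_mset r m' = m. f m'" .

text \<open>
  Compositions are lists of positive naturals and partitions are weakly decreasing ones.  An
  ordered type is a function on \<open>nat\<close> whose value at the meaningless index 0 is pinned to \<open>[]\<close>.
\<close>

definition otype_supp :: "(nat \<Rightarrow> nat list) \<Rightarrow> nat set" where
  "otype_supp \<delta> = {i. \<delta> i \<noteq> []}"

definition OTyp :: "nat \<Rightarrow> (nat \<Rightarrow> nat list) set" where
  "OTyp n = {\<delta>. \<delta> 0 = [] \<and> (\<forall>i. 0 \<notin> set (\<delta> i)) \<and> finite (otype_supp \<delta>) \<and>
                (\<Sum>i\<in>otype_supp \<delta>. i * sum_list (\<delta> i)) = n}"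

definition Typ :: "nat \<Rightarrow> (nat \<Rightarrow> nat list) set" where
  "Typ n = {\<tau> \<in> OTyp n. \<forall>i. sorted_wrt (\<ge>) (\<tau> i)}"

definition OTyp_div :: "nat \<Rightarrow> nat \<Rightarrow> (nat \<Rightarrow> nat list) set" where
  "OTyp_div r n = {\<delta> \<in> OTyp n. \<forall>i. r dvd sum_list (\<delta> i)}"

definition psort :: "(nat \<Rightarrow> nat list) \<Rightarrow> nat \<Rightarrow> nat list" where
  "psort \<delta> = (\<lambda>i. rev (sort (\<delta> i)))"

text \<open>The block \<open>d\<^sup>r\<close> is represented by the pair \<open>(d, r)\<close>.\<close>

definition block_list :: "(nat \<Rightarrow> nat list) \<Rightarrow> (nat \<times> nat) list" where
  "block_list \<tau> = concat (map (\<lambda>d. map (Pair d) (\<tau> d)) (sorted_list_of_set (otype_supp \<tau>)))"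

definition blocks :: "(nat \<Rightarrow> nat list) \<Rightarrow> (nat \<times> nat) multiset" where
  "blocks \<tau> = mset (block_list \<tau>)"

text \<open>
  The variable \<open>x\<^sub>i\<^sub>j\<close>, of degree \<open>i\<close>, is the pair \<open>(i, j)\<close> with \<open>i, j \<ge> 1\<close>; all series below
  have coefficient 0 at monomials containing other pairs.
\<close>

type_synonym psr = "(nat \<times> nat) mfps"

definition mdeg :: "(nat \<times> nat) multiset \<Rightarrow> nat" where
  "mdeg m = (\<Sum>(i, j)\<in>#m. i)"

text \<open>\<open>h_var i n\<close> is the complete homogeneous symmetric function \<open>h\<^sub>n(x\<^sub>i\<^sub>1, x\<^sub>i\<^sub>2, \<dots>)\<close>.\<close>

definition h_var :: "nat \<Rightarrow> nat \<Rightarrow> psr" where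
  "h_var i n = Abs_mfps (\<lambda>m. if set_mset m \<subseteq> {i} \<times> {1..} \<and> size m = n then 1 else 0)"

definition h_otimes :: "(nat \<Rightarrow> nat list) \<Rightarrow> psr" where
  "h_otimes \<delta> = (\<Prod>i\<in>otype_supp \<delta>. \<Prod>b\<leftarrow>\<delta> i. h_var i b)"

definition H_deg :: "nat \<Rightarrow> psr" where
  "H_deg d = Abs_mfps (\<lambda>m. if set_mset m \<subseteq> {1..} \<times> {1..} \<and> mdeg m = d then 1 else 0)"

definition H_block :: "nat \<Rightarrow> nat \<Rightarrow> psr" where
  "H_block d r = power_vars r (H_deg d)"

definition H_type :: "(nat \<Rightarrow> nat list) \<Rightarrow> psr" where
  "H_type \<sigma> = (\<Prod>(d, r)\<leftarrow>block_list \<sigma>. H_block d r)"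

text \<open>
  The coefficient of \<open>h_otimes \<tau>\<close> in the expansion of \<open>f\<close> in the basis of all \<open>h_otimes \<rho>\<close>,
  \<open>\<rho>\<close> a type of \<open>n\<close>.
\<close>

definition h_coeff :: "nat \<Rightarrow> psr \<Rightarrow> (nat \<Rightarrow> nat list) \<Rightarrow> rat" where
  "h_coeff n f \<tau> = mfps.representation (h_otimes ` Typ n) f (h_otimes \<tau>)"

definition shat_tuple :: "nat \<Rightarrow> nat list \<Rightarrow> int" where
  "shat_tuple r w =
     (let v = (\<lambda>i. (w ! i + i) mod r)
      in if inj_on v {..<r} then (-1) ^ card {(i, j). i < j \<and> j < r \<and> v i > v j} else 0)"

definition shat_comp :: "nat \<Rightarrow> nat list \<Rightarrow> int" where
  "shat_comp r \<beta> =
     (if length \<beta> \<le> r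
      then \<Sum>w | length w = r \<and> filter (\<lambda>x. x \<noteq> 0) w = \<beta>. shat_tuple r w
      else 0)"

text \<open>Indices outside the support contribute \<open>shat_comp r [] = 1\<close> (for \<open>r \<ge> 1\<close>).\<close>

definition shat :: "nat \<Rightarrow> (nat \<Rightarrow> nat list) \<Rightarrow> int" where
  "shat r \<delta> = (\<Prod>i\<in>otype_supp \<delta>. shat_comp r (\<delta> i))"

text \<open>
  A box is a pair (row, column), both counted from 0.  \<open>sheet_column k r s p\<close> is the \<open>p\<close>-th column
  (in reading order, from 0) of the \<open>k\<close>-sheets of an array with \<open>r\<close> columns and top row \<open>s\<close>.
\<close>

definition sheet_column :: "nat \<Rightarrow> nat \<Rightarrow> nat \<Rightarrow> nat \<Rightarrow> (nat \<times> nat) set" where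
  "sheet_column k r s p = {s + k * (p div r) ..< s + k * (p div r + 1)} \<times> {p mod r}"

definition wrapping :: "nat \<Rightarrow> nat \<Rightarrow> nat \<Rightarrow> nat list \<Rightarrow> (nat \<times> nat) set list" where
  "wrapping k r s \<beta> =
     map (\<lambda>j. \<Union>p\<in>{sum_list (take j \<beta>) ..< sum_list (take (Suc j) \<beta>)}. sheet_column k r s p)
       [0..<length \<beta>]"

text \<open>A polywrapping is represented by the sequence of its \<open>k\<close>-wrappings.\<close>

type_synonym polywrap = "nat \<Rightarrow> (nat \<times> nat) set list"

definition group_top :: "nat \<Rightarrow> (nat \<Rightarrow> nat list) \<Rightarrow> nat \<Rightarrow> nat" where
  "group_top r \<delta> k = (\<Sum>i\<in>{1..<k}. i * (sum_list (\<delta> i) div r))"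

definition polywrapping :: "nat \<Rightarrow> (nat \<Rightarrow> nat list) \<Rightarrow> polywrap" where
  "polywrapping r \<delta> = (\<lambda>k. wrapping k r (group_top r \<delta> k) (\<delta> k))"

definition polywrappings :: "nat \<Rightarrow> nat \<Rightarrow> polywrap set" where
  "polywrappings d r = polywrapping r ` OTyp_div r (d * r)"

text \<open>
  The ordered content is read off from the rectangles: a rectangle of height \<open>k\<close> consisting of
  \<open>b\<close> sheet-columns has \<open>k * b\<close> boxes.
\<close>

definition pocon :: "polywrap \<Rightarrow> nat \<Rightarrow> nat list" where
  "pocon D = (\<lambda>k. map (\<lambda>B. card B div k) (D k))"

lemma pocon_polywrapping:
  assumes "r \<ge> 1" "\<delta> 0 = []"
  shows "pocon (polywrapping r \<delta>) = \<delta>"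
proof
  fix k
  show "pocon (polywrapping r \<delta>) k = \<delta> k"
  proof (cases "k = 0")
    case True
    then show ?thesis using assms by (simp add: pocon_def polywrapping_def wrapping_def)
  next
    case False
    have card: "card (\<Union>p\<in>A. sheet_column k r s p) = k * card A" if "finite A" for A s
    proof -
      have disj: "sheet_column k r s p \<inter> sheet_column k r s q = {}" if "p \<noteq> q" for p q
      proof (rule ccontr)
        assume "sheet_column k r s p \<inter> sheet_column k r s q \<noteq> {}"
        then obtain x where x: "s + k * (p div r) \<le> x" "x < s + k * (p div r + 1)"
            "s + k * (q div r) \<le> x" "x < s + k * (q div r + 1)" and m: "p mod r = q mod r"
          by (auto simp: sheet_column_def)
        from x have "k * (p div r) < k * (q div r + 1)" "k * (q div r) < k * (p div r + 1)"
          by linarith+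
        then have "p div r = q div r"
          using False by (metis Suc_eq_plus1 less_Suc_eq_le le_antisym mult_less_cancel1)
        with m have "p = q" by (metis div_mult_mod_eq)
        with that show False by simp
      qed
      have "card (\<Union>p\<in>A. sheet_column k r s p) = (\<Sum>p\<in>A. card (sheet_column k r s p))"
        by (rule card_UN_disjoint) (use that disj in \<open>auto simp: sheet_column_def\<close>)
      also have "\<dots> = k * card A" by (simp add: sheet_column_def)
      finally show ?thesis .
    qed
    show ?thesis
      by (rule nth_equalityI)
         (use False in \<open>auto simp: pocon_def polywrapping_def wrapping_def card take_Suc_conv_app_nth\<close>)
  qed
qed

definition psgn_wrap :: "nat \<Rightarrow> polywrap \<Rightarrow> int" where
  "psgn_wrap r D = shat r (pocon D)"

definition bounded_polywrappings :: "nat \<Rightarrow> nat \<Rightarrow> polywrap set" where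
  "bounded_polywrappings d r = {D \<in> polywrappings d r. \<forall>k. length (D k) \<le> r}"

definition tabloids :: "(nat \<Rightarrow> nat list) \<Rightarrow> (nat \<Rightarrow> nat list) \<Rightarrow> polywrap list set" where
  "tabloids \<sigma> \<tau> =
     {T. list_all2 (\<lambda>(d, r) D. D \<in> bounded_polywrappings d r) (block_list \<sigma>) T \<and>
         (\<Sum>D\<leftarrow>T. blocks (psort (pocon D))) = blocks \<tau>}"

definition psgn :: "(nat \<Rightarrow> nat list) \<Rightarrow> polywrap list \<Rightarrow> int" where
  "psgn \<sigma> T = (\<Prod>((d, r), D)\<leftarrow>zip (block_list \<sigma>) T. psgn_wrap r D)"

end

theory Submission
  imports Defs "HOL-Library.FuncSet" "HOL-Combinatorics.Transposition"
begin

text \<open>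
  Since \<open>H_deg d\<close> is the sum over all area sequences \<open>\<alpha>\<close> with \<open>\<Sum>i. i * \<alpha> i = d\<close> of the products of
  the \<open>h_var i (\<alpha> i)\<close>, the expansion of \<open>H_block d r\<close> reduces to the plethysm identity
  \<open>h\<^sub>a(x\<^sub>1\<^sup>r, x\<^sub>2\<^sup>r, \<dots>) = \<Sum>w. s\<^sub>r(w) h\<^bsub>w 0\<^esub> \<dots> h\<^bsub>w (r - 1)\<^esub>\<close>, the sum ranging over the
  \<open>r\<close>-tuples \<open>w\<close> of total \<open>r * a\<close>.  Comparing the coefficients of a monomial and treating one
  variable at a time, this becomes the statement that summing the sign over all ways of
  adding a tuple of total \<open>m\<close> multiplies it by 1 if \<open>r dvd m\<close> and by 0 otherwise, which a chain of
  sign-reversing involutions proves.  The case \<open>a = 1\<close> puts the power sums into the span of the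
  \<open>h_otimes\<close>; products of power sums are linearly independent by triangularity, and there are as
  many of them as of the \<open>h_otimes\<close>, so the latter are independent as well.
\<close>

subsection \<open>The cyclic sign\<close>

text \<open>The factor of a pair is -1 at an inversion of the residues and 0 at a coincidence, so
  one product covers both cases of \<open>shat_tuple\<close>. Taking positions \<open>u\<close>
  instead of a tuple lets the starting points vary.\<close>

definition cyc_sgn :: "nat \<Rightarrow> (nat \<Rightarrow> nat) \<Rightarrow> int" where
  "cyc_sgn r u = (\<Prod>(i, j) | i < j \<and> j < r. sgn (int (u j mod r) - int (u i mod r)))"

lemma finite_pairs_below: "finite {(i, j). i < j \<and> j < (r :: nat)}"
  by (rule finite_subset[of _ "{..<r} \<times> {..<r}"]) auto

lemma prod_minus_one_if:
  "finite A \<Longrightarrow> (\<Prod>x\<in>A. if Q x then - 1 else (1 :: int)) = (- 1) ^ card {x \<in> A. Q x}"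
  by (simp add: prod.If_cases Int_def)

lemma cyc_sgn_eq_0:
  assumes "a < r" "b < r" "a \<noteq> b" "u a mod r = u b mod r"
  shows "cyc_sgn r u = 0"
proof -
  have "(min a b, max a b) \<in> {(i, j). i < j \<and> j < r}"
    using assms by auto
  moreover have "sgn (int (u (max a b) mod r) - int (u (min a b) mod r)) = 0"
    using assms(4) by (simp add: max_def min_def)
  ultimately show ?thesis
    unfolding cyc_sgn_def by (subst prod_zero_iff[OF finite_pairs_below]) fastforce
qed

lemma cyc_sgn_cong:
  assumes "\<And>i. i < r \<Longrightarrow> u i mod r = u' i mod r"
  shows "cyc_sgn r u = cyc_sgn r u'"
  unfolding cyc_sgn_def by (rule prod.cong) (use assms in auto)

lemma shat_tuple_eq_cyc_sgn: "shat_tuple r w = cyc_sgn r (\<lambda>i. w ! i + i)"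
proof (cases "inj_on (\<lambda>i. (w ! i + i) mod r) {..<r}")
  case True
  have "cyc_sgn r (\<lambda>i. w ! i + i) =
      (\<Prod>p\<in>{(i, j). i < j \<and> j < r}.
         if (w ! fst p + fst p) mod r > (w ! snd p + snd p) mod r then - 1 else 1)"
    unfolding cyc_sgn_def
  proof (intro prod.cong refl, clarify)
    fix i j :: nat assume "i < j" "j < r"
    then have "(w ! i + i) mod r \<noteq> (w ! j + j) mod r"
      using inj_onD[OF True, of i j] by auto
    then show "sgn (int ((w ! j + j) mod r) - int ((w ! i + i) mod r)) =
        (if (w ! fst (i, j) + fst (i, j)) mod r > (w ! snd (i, j) + snd (i, j)) mod r then - 1 else 1)"
      by (auto simp: sgn_if simp flip: of_nat_diff)
  qed
  also have "\<dots> = (- 1) ^ card {p \<in> {(i, j). i < j \<and> j < r}.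
      (w ! fst p + fst p) mod r > (w ! snd p + snd p) mod r}"
    by (rule prod_minus_one_if[OF finite_pairs_below])
  also have "{p \<in> {(i, j). i < j \<and> j < r}. (w ! fst p + fst p) mod r > (w ! snd p + snd p) mod r}
      = {(i, j). i < j \<and> j < r \<and> (w ! i + i) mod r > (w ! j + j) mod r}"
    by auto
  finally show ?thesis using True by (simp add: shat_tuple_def Let_def)
next
  case False
  then obtain i j where "i < r" "j < r" "i \<noteq> j" "(w ! i + i) mod r = (w ! j + j) mod r"
    by (auto simp: inj_on_def)
  then have "cyc_sgn r (\<lambda>i. w ! i + i) = 0" by (rule cyc_sgn_eq_0)
  with False show ?thesis by (simp add: shat_tuple_def Let_def)
qed

text \<open>The transposition permutes the unordered pairs of indices. A factor changes sign exactly
  when its pair is reversed, and a transposition reverses an odd number of pairs.\<close>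

lemma cyc_sgn_transpose_less:
  assumes "a < b" "b < r"
  shows "cyc_sgn r (u \<circ> transpose a b) = - cyc_sgn r u"
proof -
  let ?P = "{(i, j). i < j \<and> j < r}"
  define t where "t = transpose a b"
  \<comment> \<open>\<open>\<phi>\<close> moves a pair by \<open>t\<close> and sorts the result, so
    it is an involution on the increasing pairs; the sorting is what produces the signs.\<close>
  define \<phi> where "\<phi> = (\<lambda>(i, j). if t i < t j then (t i, t j) else (t j, t i))"
  define g where "g = (\<lambda>(i, j). sgn (int (u j mod r) - int (u i mod r)))"
  have tt: "t (t i) = i" for i by (simp add: t_def)
  have lt: "t i < r" if "i < r" for i
    using that assms by (auto simp: t_def transpose_def)
  have "cyc_sgn r (u \<circ> t) = (\<Prod>p\<in>?P. (if t (fst p) > t (snd p) then - 1 else 1) * g (\<phi> p))"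
    unfolding cyc_sgn_def
  proof (intro prod.cong refl, clarify)
    fix i j :: nat assume ij: "i < j" "j < r"
    then have "t i \<noteq> t j" by (metis tt nat_neq_iff)
    then show "sgn (int ((u \<circ> t) j mod r) - int ((u \<circ> t) i mod r)) =
        (if t (fst (i, j)) > t (snd (i, j)) then - 1 else 1) * g (\<phi> (i, j))"
      by (auto simp: \<phi>_def g_def sgn_if)
  qed
  also have "\<dots> = (\<Prod>p\<in>?P. if t (fst p) > t (snd p) then - 1 else 1) * (\<Prod>p\<in>?P. g (\<phi> p))"
    by (rule prod.distrib)
  also have "(\<Prod>p\<in>?P. g (\<phi> p)) = (\<Prod>p\<in>?P. g p)"
  proof (rule prod.reindex_bij_witness[where i = \<phi> and j = \<phi>])
    fix p assume "p \<in> ?P"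
    then obtain i j where p: "p = (i, j)" "i < j" "j < r" by auto
    then have "t i \<noteq> t j" by (metis tt nat_neq_iff)
    then show "\<phi> (\<phi> p) = p" "\<phi> p \<in> ?P" using p lt by (auto simp: \<phi>_def tt)
    then show "\<phi> (\<phi> p) = p" "\<phi> p \<in> ?P" by auto
  qed auto
  also have "(\<Prod>p\<in>?P. if t (fst p) > t (snd p) then - 1 else (1 :: int)) =
      (- 1) ^ card {p \<in> ?P. t (fst p) > t (snd p)}"
    by (rule prod_minus_one_if[OF finite_pairs_below])
  \<comment> \<open>The reversed pairs are \<open>(a, b)\<close> itself and, for each index strictly
    between, its pairs with \<open>a\<close> and with \<open>b\<close>.\<close>
  also have "{p \<in> ?P. t (fst p) > t (snd p)} =
      insert (a, b) ({a} \<times> {a<..<b} \<union> {a<..<b} \<times> {b})"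
  proof -
    have "(i, j) \<in> {p \<in> ?P. t (fst p) > t (snd p)} \<longleftrightarrow>
        (i, j) \<in> insert (a, b) ({a} \<times> {a<..<b} \<union> {a<..<b} \<times> {b})" for i j
      using assms unfolding t_def transpose_def
      by (cases "i = a"; cases "i = b"; cases "j = a"; cases "j = b") auto
    then show ?thesis by (simp only: set_eq_iff split_paired_All) blast
  qed
  also have "card \<dots> = Suc (2 * (b - a - 1))"
    by (subst card_insert_disjoint, auto, subst card_Un_disjoint) (use assms in auto)
  finally show ?thesis by (simp add: t_def cyc_sgn_def g_def)
qed

lemma cyc_sgn_transpose:
  assumes "a < r" "b < r" "a \<noteq> b"
  shows "cyc_sgn r (u \<circ> transpose a b) = - cyc_sgn r u"
  using cyc_sgn_transpose_less[of a b r u] cyc_sgn_transpose_less[of b a r u] assms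
  by (cases "a < b") (auto simp: transpose_commute)

section \<open>Weak compositions and sign-reversing involutions\<close>

definition weak_comps :: "nat \<Rightarrow> nat \<Rightarrow> (nat \<Rightarrow> nat) set" where
  "weak_comps r m = {c. (\<forall>i\<ge>r. c i = 0) \<and> (\<Sum>i<r. c i) = m}"

lemma finite_weak_comps: "finite (weak_comps r m)"
proof (rule finite_subset)
  show "weak_comps r m \<subseteq> {c. \<forall>i. (i \<in> {..<r} \<longrightarrow> c i \<in> {..m}) \<and> (i \<notin> {..<r} \<longrightarrow> c i = 0)}"
    by (auto simp: weak_comps_def intro: member_le_sum)
  show "finite {c. \<forall>i. (i \<in> {..<r} \<longrightarrow> c i \<in> {..m}) \<and> (i \<notin> {..<r} \<longrightarrow> c i = (0 :: nat))}"
    by (rule finite_set_of_finite_funs) auto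
qed

text \<open>Reindexing along \<open>\<phi>\<close> identifies the sum with its own negative. Fixed
  points do no harm, as the summand vanishes there.\<close>

lemma sum_eq_0_by_involution:
  fixes f :: "'a \<Rightarrow> int"
  assumes "\<And>x. x \<in> A \<Longrightarrow> \<phi> x \<in> A" "\<And>x. x \<in> A \<Longrightarrow> \<phi> (\<phi> x) = x" "\<And>x. x \<in> A \<Longrightarrow> f (\<phi> x) = - f x"
  shows "sum f A = 0"
proof -
  have "sum f A = (\<Sum>x\<in>A. - f x)"
    by (rule sum.reindex_bij_witness[where i = \<phi> and j = \<phi>]) (use assms in auto)
  then show ?thesis by (simp add: sum_negf)
qed

lemma sum_upd2:
  fixes c :: "nat \<Rightarrow> nat"
  assumes "a < r" "b < r" "a \<noteq> b" "x + y = c a + c b"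
  shows "(\<Sum>i<r. (c(a := x, b := y)) i) = (\<Sum>i<r. c i)"
proof -
  have 1: "{..<r} = insert a (insert b ({..<r} - {a, b}))" using assms by auto
  have "(\<Sum>i<r. (c(a := x, b := y)) i) = x + (y + (\<Sum>i\<in>{..<r} - {a, b}. (c(a := x, b := y)) i))"
    by (subst 1) (use assms(3) in simp)
  also have "(\<Sum>i\<in>{..<r} - {a, b}. (c(a := x, b := y)) i) = (\<Sum>i\<in>{..<r} - {a, b}. c i)"
    by (rule sum.cong) auto
  also have "x + (y + \<dots>) = c a + (c b + \<dots>)" using assms by simp
  also have "\<dots> = (\<Sum>i<r. c i)"
    by (subst (2) 1) (use assms(3) in simp)
  finally show ?thesis .
qed

text \<open>
  Think of \<open>r\<close> particles on a cycle of length \<open>r\<close>, the \<open>i\<close>-th one at \<open>u i\<close> and about to move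
  \<open>c i\<close> steps.  If particle \<open>a\<close> sits just before particle \<open>b\<close> and moves at all, letting the two
  exchange their journeys when \<open>a\<close> reaches \<open>b\<close> reverses the sign.
\<close>

lemma sum_cyc_sgn_neighbours:
  assumes "a < r" "b < r" "a \<noteq> b" "u b mod r = Suc (u a) mod r"
    and Z: "a \<notin> Z" "b \<notin> Z"
  shows "(\<Sum>c | c \<in> weak_comps r m \<and> (\<forall>i\<in>Z. c i = 0) \<and> c a \<noteq> 0. cyc_sgn r (\<lambda>i. u i + c i)) = 0"
\<comment> \<open>The first of the \<open>c a\<close> steps takes \<open>a\<close> to the residue of
  \<open>b\<close>. From there the two exchange what is left: \<open>b\<close> receives
  \<open>c a - 1\<close> steps, and \<open>a\<close> its first step followed by the
  \<open>c b\<close> steps of \<open>b\<close>. So the entry at \<open>a\<close> stays positive, and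
  the particles in \<open>Z\<close> stay at rest.\<close>
proof (rule sum_eq_0_by_involution[where \<phi> = "\<lambda>c. c(a := Suc (c b), b := c a - 1)"])
  fix c assume c: "c \<in> {c. c \<in> weak_comps r m \<and> (\<forall>i\<in>Z. c i = 0) \<and> c a \<noteq> 0}"
  let ?c = "c(a := Suc (c b), b := c a - 1)"
  have "(\<Sum>i<r. ?c i) = (\<Sum>i<r. c i)" by (rule sum_upd2) (use assms c in auto)
  then show "?c \<in> {c. c \<in> weak_comps r m \<and> (\<forall>i\<in>Z. c i = 0) \<and> c a \<noteq> 0}"
    using c assms by (auto simp: weak_comps_def)
  show "?c(a := Suc (?c b), b := ?c a - 1) = c" using c assms by auto
  have "cyc_sgn r (\<lambda>i. u i + ?c i) = cyc_sgn r ((\<lambda>i. u i + c i) \<circ> transpose a b)"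
  proof (rule cyc_sgn_cong)
    fix i
    have "(Suc (u a) + k) mod r = (u b + k) mod r" for k
      by (metis assms(4) mod_add_left_eq)
    from this[of "c a - 1"] this[of "c b"] c
    show "(u i + ?c i) mod r = ((\<lambda>i. u i + c i) \<circ> transpose a b) i mod r"
      using assms(3) by (auto simp: transpose_def)
  qed
  also have "\<dots> = - cyc_sgn r (\<lambda>i. u i + c i)"
    by (rule cyc_sgn_transpose) (use assms in auto)
  finally show "cyc_sgn r (\<lambda>i. u i + ?c i) = - cyc_sgn r (\<lambda>i. u i + c i)" .
qed

text \<open>Particles that start at the same residue can exchange their whole journeys, which
  reverses the sign.\<close>

lemma sum_cyc_sgn_coincident:
  assumes "a < r" "b < r" "a \<noteq> b" "u a mod r = u b mod r"
  shows "(\<Sum>c\<in>weak_comps r m. cyc_sgn r (\<lambda>i. u i + c i)) = 0"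
proof (rule sum_eq_0_by_involution[where \<phi> = "\<lambda>c. c(a := c b, b := c a)"])
  fix c assume c: "c \<in> weak_comps r m"
  let ?c = "c(a := c b, b := c a)"
  have "(\<Sum>i<r. ?c i) = (\<Sum>i<r. c i)" by (rule sum_upd2) (use assms c in auto)
  then show "?c \<in> weak_comps r m" using c assms by (auto simp: weak_comps_def)
  show "?c(a := ?c b, b := ?c a) = c" using assms by auto
  have "cyc_sgn r (\<lambda>i. u i + ?c i) = cyc_sgn r ((\<lambda>i. u i + c i) \<circ> transpose a b)"
  proof (rule cyc_sgn_cong)
    fix i
    have "(u a + k) mod r = (u b + k) mod r" for k
      by (metis assms(4) mod_add_left_eq)
    then show "(u i + ?c i) mod r = ((\<lambda>i. u i + c i) \<circ> transpose a b) i mod r"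
      using assms(3) by (auto simp: transpose_def)
  qed
  also have "\<dots> = - cyc_sgn r (\<lambda>i. u i + c i)"
    by (rule cyc_sgn_transpose) (use assms in auto)
  finally show "cyc_sgn r (\<lambda>i. u i + ?c i) = - cyc_sgn r (\<lambda>i. u i + c i)" .
qed

text \<open>If two residues coincide, both sides are 0. Otherwise each residue carries exactly one
  particle, and cancellation against the next neighbour freezes the particles at residues 0, ..., r
  - 2 in turn. What remains is the last particle making all \<open>m\<close> steps: it returns to
  its own residue if \<open>r\<close> divides \<open>m\<close>, and otherwise lands on an occupied
  one.\<close>

lemma sum_cyc_sgn_weak_comps:
  assumes "r \<ge> 1"
  shows "(\<Sum>c\<in>weak_comps r m. cyc_sgn r (\<lambda>i. u i + c i)) = (if r dvd m then cyc_sgn r u else 0)"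
proof (cases "inj_on (\<lambda>i. u i mod r) {..<r}")
  case False
  then obtain i j where ij: "i < r" "j < r" "i \<noteq> j" "u i mod r = u j mod r"
    by (auto simp: inj_on_def)
  then show ?thesis using sum_cyc_sgn_coincident[OF ij] cyc_sgn_eq_0[OF ij] by simp
next
  case True
  then have "(\<lambda>i. u i mod r) ` {..<r} = {..<r}"
    by (intro card_subset_eq) (use assms in \<open>auto simp: card_image\<close>)
  then have "\<exists>i<r. u i mod r = s" if "s < r" for s
    using that by (metis (no_types, lifting) imageE lessThan_iff)
  \<comment> \<open>\<open>q s\<close> is the particle at residue \<open>s\<close>.\<close>
  then obtain q where q: "\<And>s. s < r \<Longrightarrow> q s < r \<and> u (q s) mod r = s"
    by metis
  have qinj: "q s \<noteq> q t" if "s < r" "t < r" "s \<noteq> t" for s t using q that by metis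
  have qsurj: "\<exists>s<r. i = q s" if "i < r" for i
  proof (intro exI[of _ "u i mod r"] conjI)
    show less: "u i mod r < r" using that by simp
    show "i = q (u i mod r)"
      by (rule inj_onD[OF True]) (use q[OF less] that in auto)
  qed
  \<comment> \<open>\<open>Z k\<close> keeps the tuples in which the particles at the first
    \<open>k\<close> residues rest. The tuples lost from \<open>Z k\<close> to
    \<open>Z (Suc k)\<close> cancel by the exchange between \<open>q k\<close> and
    \<open>q (Suc k)\<close>.\<close>
  define Z where "Z = (\<lambda>k. {c \<in> weak_comps r m. \<forall>i\<in>q ` {..<k}. c i = 0})"
  let ?f = "\<lambda>c. cyc_sgn r (\<lambda>i. u i + c i)"
  have Zfin: "finite (Z k)" for k
    by (rule finite_subset[OF _ finite_weak_comps[of r m]]) (auto simp: Z_def)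
  have step: "sum ?f (Z (Suc k)) = sum ?f (Z k)" if k: "Suc k < r" for k
  proof -
    have "Z (Suc k) \<subseteq> Z k" by (auto simp: Z_def)
    then have "sum ?f (Z k) = sum ?f (Z k - Z (Suc k)) + sum ?f (Z (Suc k))"
      by (rule sum.subset_diff[OF _ Zfin])
    also have "Z k - Z (Suc k) =
        {c \<in> weak_comps r m. (\<forall>i\<in>q ` {..<k}. c i = 0) \<and> c (q k) \<noteq> 0}"
      by (auto simp: Z_def less_Suc_eq)
    also have "sum ?f \<dots> = 0"
    proof (rule sum_cyc_sgn_neighbours[where b = "q (Suc k)"])
      show "u (q (Suc k)) mod r = Suc (u (q k)) mod r"
        using q[of k] q[of "Suc k"] k mod_Suc_eq[of "u (q k)" r] by simp
      show "q k \<noteq> q (Suc k)" by (rule qinj) (use k in auto)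
      have "q j \<noteq> q k \<and> q j \<noteq> q (Suc k)" if "j < k" for j
        by (intro conjI qinj) (use k that in auto)
      then show "q k \<notin> q ` {..<k}" "q (Suc k) \<notin> q ` {..<k}" by force+
    qed (use q[of k] q[of "Suc k"] k in auto)
    finally show ?thesis by simp
  qed
  have "sum ?f (weak_comps r m) = sum ?f (Z k)" if "k < r" for k
    using that
  proof (induction k)
    case 0 then show ?case by (simp add: Z_def)
  next
    case (Suc k) then show ?case using step[of k] by simp
  qed
  \<comment> \<open>The freezing ends with one mobile particle, since \<open>step\<close> requires a
    next residue below \<open>r\<close>.\<close>
  from this[of "r - 1"] have "sum ?f (weak_comps r m) = sum ?f (Z (r - 1))" using assms by simp
  also have "Z (r - 1) = {(\<lambda>_. 0)(q (r - 1) := m)}"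
  proof -
    let ?a = "q (r - 1)"
    have a: "?a < r" using q[of "r - 1"] assms by simp
    have sum1: "(\<Sum>i<r. c i) = c ?a" if "\<forall>i<r. i \<noteq> ?a \<longrightarrow> c i = 0" for c :: "nat \<Rightarrow> nat"
    proof -
      have "(\<Sum>i<r. c i) = (\<Sum>i\<in>{?a}. c i)"
        by (rule sum.mono_neutral_right) (use that a in auto)
      then show ?thesis by simp
    qed
    have "c = (\<lambda>_. 0)(?a := m)" if "c \<in> Z (r - 1)" for c
    proof -
      have 0: "\<forall>i<r. i \<noteq> ?a \<longrightarrow> c i = 0"
      proof (intro allI impI)
        fix i assume "i < r" "i \<noteq> ?a"
        then obtain s where "s < r" "i = q s" "s \<noteq> r - 1" using qsurj by auto
        then show "c i = 0" using that by (auto simp: Z_def)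
      qed
      show ?thesis using that sum1[OF 0] 0 by (auto simp: Z_def weak_comps_def fun_eq_iff not_less) (metis not_le)
    qed
    moreover have "(\<lambda>_. 0)(?a := m) \<in> Z (r - 1)"
    proof -
      have "q k \<noteq> ?a" if "k < r - 1" for k using qinj[of k "r - 1"] that by auto
      moreover have "(\<Sum>i<r. ((\<lambda>_. 0)(?a := m)) i) = m" by (subst sum1) auto
      ultimately show ?thesis using a by (auto simp: Z_def weak_comps_def)
    qed
    ultimately show ?thesis by blast
  qed
  also have "sum ?f \<dots> = (if r dvd m then cyc_sgn r u else 0)"
  proof -
    let ?a = "q (r - 1)" and ?c = "(\<lambda>_. 0)(q (r - 1) := m)"
    have a: "?a < r" using q[of "r - 1"] assms by simp
    show ?thesis
    proof (cases "r dvd m")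
      case True
      then have "?f ?c = cyc_sgn r u"
        by (intro cyc_sgn_cong) (auto simp: dvd_def)
      then show ?thesis using True by simp
    next
      case False
      \<comment> \<open>\<open>?b\<close> is the particle at the residue where \<open>?a\<close>
        lands. It differs from \<open>?a\<close> and is at rest, so two final residues
        coincide.\<close>
      let ?b = "q ((u ?a + m) mod r)"
      have b: "?b < r" "u ?b mod r = (u ?a + m) mod r"
        using q[of "(u ?a + m) mod r"] assms by auto
      have "?a \<noteq> ?b"
      proof
        assume "?a = ?b"
        then have "(u ?a + m) mod r = u ?a mod r" using b by simp
        then have "r dvd m" by (metis add_diff_cancel_left' le_add1 mod_eq_dvd_iff_nat)
        then show False using False by simp
      qed
      then have "?f ?c = 0" using a b by (intro cyc_sgn_eq_0[of ?a _ ?b]) auto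
      then show ?thesis using False by simp
    qed
  qed
  finally show ?thesis .
qed

subsection \<open>Plethysm of power sums and complete homogeneous functions\<close>

lemma mcoeff_0 [simp]: "mcoeff 0 m = 0"
  by transfer simp

lemma mcoeff_1: "mcoeff 1 m = (if m = {#} then 1 else 0)"
  by transfer simp

lemma mcoeff_add [simp]: "mcoeff (f + g) m = mcoeff f m + mcoeff g m"
  by transfer simp

lemma mcoeff_uminus [simp]: "mcoeff (- f) m = - mcoeff f m"
  by transfer simp

lemma mcoeff_mult: "mcoeff (f * g) m = (\<Sum>(a, b) | a + b = m. mcoeff f a * mcoeff g b)"
  by transfer simp

lemma mcoeff_scale [simp]: "mcoeff (mfps_scale c f) m = c * mcoeff f m"
  by transfer simp

lemma mcoeff_sum [simp]: "mcoeff (sum f A) m = (\<Sum>x\<in>A. mcoeff (f x) m)"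
  by (induction A rule: infinite_finite_induct) auto

lemma mcoeff_of_int_mult [simp]: "mcoeff (of_int k * f) m = of_int k * mcoeff f m"
proof -
  have *: "mcoeff (of_nat n * f) m = of_nat n * mcoeff f m" for n
    by (induction n) (simp_all add: distrib_right)
  show ?thesis
    by (cases k rule: int_cases2) (simp_all add: *)
qed

lemma mfps_scale_of_int: "mfps_scale (of_int k) f = of_int k * f"
  by (rule mfps_eqI) simp

lemma mcoeff_Abs [simp]: "mcoeff (Abs_mfps f) m = f m"
  by (simp add: Abs_mfps_inverse)

section \<open>Ordered factorizations of a monomial\<close>

definition msplits :: "nat \<Rightarrow> 'v multiset \<Rightarrow> (nat \<Rightarrow> 'v multiset) set" where
  "msplits r m = {M. (\<forall>k\<ge>r. M k = {#}) \<and> (\<Sum>k<r. M k) = m}"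

lemma msplits_subset:
  assumes "M \<in> msplits r m"
  shows "M k \<subseteq># m"
proof (cases "k < r")
  case True
  then have "m = M k + (\<Sum>j\<in>{..<r} - {k}. M j)"
    using assms by (auto simp: msplits_def sum.remove)
  then show ?thesis by simp
qed (use assms in \<open>auto simp: msplits_def\<close>)

lemma finite_msplits: "finite (msplits r m)"
proof (rule finite_subset)
  show "msplits r m \<subseteq> {M. \<forall>k. (k \<in> {..<r} \<longrightarrow> M k \<in> {a. a \<subseteq># m}) \<and> (k \<notin> {..<r} \<longrightarrow> M k = {#})}"
    using msplits_subset by (auto simp: msplits_def)
  show "finite {M. \<forall>k. (k \<in> {..<r} \<longrightarrow> M k \<in> {a. a \<subseteq># m}) \<and> (k \<notin> {..<r} \<longrightarrow> M k = {#})}"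
    by (rule finite_set_of_finite_funs) (auto simp: finite_submultisets)
qed

lemma mcoeff_prod:
  "mcoeff (\<Prod>k<r. f k) m = (\<Sum>M\<in>msplits r m. \<Prod>k<r. mcoeff (f k) (M k))"
proof (induction r arbitrary: m)
  case 0
  have "msplits 0 m = (if m = {#} then {\<lambda>_. {#}} else {})"
    by (auto simp: msplits_def)
  then show ?case by (simp add: mcoeff_1)
next
  case (Suc r)
  have "mcoeff (\<Prod>k<Suc r. f k) m =
      (\<Sum>p | fst p + snd p = m. \<Sum>M\<in>msplits r (fst p).
         (\<Prod>k<r. mcoeff (f k) (M k)) * mcoeff (f r) (snd p))"
    by (simp add: mcoeff_mult Suc sum_distrib_right case_prod_unfold)
  also have "\<dots> = (\<Sum>q\<in>Sigma {p. fst p + snd p = m} (\<lambda>p. msplits r (fst p)).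
         (\<Prod>k<r. mcoeff (f k) (snd q k)) * mcoeff (f r) (snd (fst q)))"
    by (subst sum.Sigma)
       (auto simp: finite_msplits finite_msplit[unfolded case_prod_unfold] case_prod_unfold)
  also have "\<dots> = (\<Sum>M\<in>msplits (Suc r) m. \<Prod>k<Suc r. mcoeff (f k) (M k))"
  \<comment> \<open>A splitting into \<open>Suc r\<close> parts is a splitting in two, with the last
    part as second component, together with an \<open>r\<close>-fold splitting of the first
    component. Index \<open>r\<close> is reset to \<open>{#}\<close> as \<open>msplits\<close>
    demands.\<close>
  proof (rule sum.reindex_bij_witness[where
        i = "\<lambda>M. ((\<Sum>k<r. M k, M r), M(r := {#}))" and j = "\<lambda>q. (snd q)(r := snd (fst q))"])
    fix q assume q: "q \<in> Sigma {p. fst p + snd p = m} (\<lambda>p. msplits r (fst p))"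
    obtain a b M where [simp]: "q = ((a, b), M)" by (metis prod.collapse)
    have *: "(\<Sum>k<r. (M(r := b)) k) = (\<Sum>k<r. M k)" by (rule sum.cong) auto
    show "((\<Sum>k<r. ((snd q)(r := snd (fst q))) k, ((snd q)(r := snd (fst q))) r),
           ((snd q)(r := snd (fst q)))(r := {#})) = q"
      using q * by (auto simp: msplits_def)
    show "(snd q)(r := snd (fst q)) \<in> msplits (Suc r) m"
      using q * by (auto simp: msplits_def)
    have "(\<Prod>k<r. mcoeff (f k) ((M(r := b)) k)) = (\<Prod>k<r. mcoeff (f k) (M k))"
      by (rule prod.cong) auto
    then show "(\<Prod>k<Suc r. mcoeff (f k) (((snd q)(r := snd (fst q))) k)) =
        (\<Prod>k<r. mcoeff (f k) (snd q k)) * mcoeff (f r) (snd (fst q))"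
      by simp
  next
    fix M assume M: "M \<in> msplits (Suc r) m"
    show "(snd ((\<Sum>k<r. M k, M r), M(r := {#})))(r := snd (fst ((\<Sum>k<r. M k, M r), M(r := {#})))) = M"
      by simp
    have *: "(\<Sum>k<r. (M(r := {#})) k) = (\<Sum>k<r. M k)" by (rule sum.cong) auto
    show "((\<Sum>k<r. M k, M r), M(r := {#})) \<in> Sigma {p. fst p + snd p = m} (\<lambda>p. msplits r (fst p))"
      using M * by (auto simp: msplits_def Suc_le_eq)
  qed
  finally show ?case .
qed

lemma filter_mset_sum: "filter_mset P (sum f A) = (\<Sum>x\<in>A. filter_mset P (f x))"
  by (induction A rule: infinite_finite_induct) auto

text \<open>The exponents of different variables are distributed independently. For one variable the
  distributions are the weak compositions of its exponent, and \<open>sum_cyc_sgn_weak_comps\<close>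
  evaluates the sum over them, with the other variables absorbed into the starting
  positions.\<close>

lemma sum_cyc_sgn_msplits:
  assumes "r \<ge> 1"
  shows "(\<Sum>M\<in>msplits r m. cyc_sgn r (\<lambda>i. u i + size (M i))) =
    (if \<forall>x. r dvd count m x then cyc_sgn r u else 0)"
proof -
  \<comment> \<open>The induction runs over a finite set containing the variables of
    \<open>m\<close>, so that each step removes one variable with its full exponent.\<close>
  have "(\<Sum>M\<in>msplits r m. cyc_sgn r (\<lambda>i. u i + size (M i))) =
      (if \<forall>x. r dvd count m x then cyc_sgn r u else 0)" if "finite X" "set_mset m \<subseteq> X" for X
    using that
  proof (induction X arbitrary: m)
    case empty
    then have m: "m = {#}" by simp
    have "msplits r m = {\<lambda>_. {#}}"
    proof (intro equalityI subsetI)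
      fix M assume "M \<in> msplits r m"
      then have "M k = {#}" for k using msplits_subset[of M r m k] m by simp
      then show "M \<in> {\<lambda>_. {#}}" by auto
    qed (auto simp: msplits_def m)
    then show ?case by (simp add: m)
  next
    case (insert x X)
    let ?m = "filter_mset (\<lambda>y. y \<noteq> x) m"
    \<comment> \<open>Each part is separated into its \<open>x\<close>-free portion and its
      multiplicity of \<open>x\<close>; the multiplicities form a weak composition of
      \<open>count m x\<close>.\<close>
    have "(\<Sum>M\<in>msplits r m. cyc_sgn r (\<lambda>i. u i + size (M i))) =
        (\<Sum>(M, c)\<in>msplits r ?m \<times> weak_comps r (count m x).
           cyc_sgn r (\<lambda>i. u i + size (M i) + c i))"
    proof (rule sum.reindex_bij_witness[where
          i = "\<lambda>(M, c). (\<lambda>i. M i + replicate_mset (c i) x)" and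
          j = "\<lambda>M. (\<lambda>i. filter_mset (\<lambda>y. y \<noteq> x) (M i), \<lambda>i. count (M i) x)"])
      fix M assume M: "M \<in> msplits r m"
      have split: "filter_mset (\<lambda>y. y \<noteq> x) a + replicate_mset (count a x) x = a" for a
        by (rule multiset_eqI) auto
      show "(case (\<lambda>i. filter_mset (\<lambda>y. y \<noteq> x) (M i), \<lambda>i. count (M i) x) of
          (M, c) \<Rightarrow> \<lambda>i. M i + replicate_mset (c i) x) = M"
        by (simp add: split)
      show "(\<lambda>i. filter_mset (\<lambda>y. y \<noteq> x) (M i), \<lambda>i. count (M i) x) \<in>
          msplits r ?m \<times> weak_comps r (count m x)"
        using M by (auto simp: msplits_def weak_comps_def count_sum filter_mset_sum)
      have "size (M i) = size (filter_mset (\<lambda>y. y \<noteq> x) (M i)) + count (M i) x" for i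
        by (subst (1) split[symmetric]) (simp only: size_union size_replicate_mset)
      then show "(case (\<lambda>i. filter_mset (\<lambda>y. y \<noteq> x) (M i), \<lambda>i. count (M i) x) of
          (M, c) \<Rightarrow> cyc_sgn r (\<lambda>i. u i + size (M i) + c i)) = cyc_sgn r (\<lambda>i. u i + size (M i))"
        by (simp add: add.assoc)
    next
      fix p assume "p \<in> msplits r ?m \<times> weak_comps r (count m x)"
      then obtain M c where p: "p = (M, c)" and M: "M \<in> msplits r ?m"
        and c: "c \<in> weak_comps r (count m x)" by auto
      have nx: "x \<notin># M i" for i using mset_subset_eqD[OF msplits_subset[OF M, of i]] by fastforce
      then have f: "filter_mset (\<lambda>y. y \<noteq> x) (M i) = M i" for i
        by (auto simp: filter_mset_eq_conv)
      show "(\<lambda>M. (\<lambda>i. filter_mset (\<lambda>y. y \<noteq> x) (M i), \<lambda>i. count (M i) x))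
          ((\<lambda>(M, c). (\<lambda>i. M i + replicate_mset (c i) x)) p) = p"
        using nx by (auto simp: p f not_in_iff)
      have "(\<Sum>k<r. replicate_mset (c k) x) = replicate_mset (count m x) x"
        using c by (intro multiset_eqI) (auto simp: count_sum weak_comps_def)
      then show "(\<lambda>(M, c). (\<lambda>i. M i + replicate_mset (c i) x)) p \<in> msplits r m"
        using M c by (auto simp: p msplits_def weak_comps_def sum.distrib intro!: multiset_eqI)
    qed
    also have "\<dots> = (\<Sum>M\<in>msplits r ?m. if r dvd count m x then cyc_sgn r (\<lambda>i. u i + size (M i)) else 0)"
      by (simp add: sum.cartesian_product[symmetric] sum_cyc_sgn_weak_comps[OF assms])
    also have "\<dots> = (if r dvd count m x then
        (if \<forall>y. r dvd count ?m y then cyc_sgn r u else 0) else 0)"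
      using insert by (subst insert.IH[symmetric]) auto
    also have "\<dots> = (if \<forall>y. r dvd count m y then cyc_sgn r u else 0)"
      by auto
    finally show ?case .
  qed
  from this[of "set_mset m"] show ?thesis by simp
qed

text \<open>\<open>h_pow i r a\<close> is \<open>h_var i a\<close> with every variable replaced by its \<open>r\<close>-th power.\<close>

definition h_pow :: "nat \<Rightarrow> nat \<Rightarrow> nat \<Rightarrow> psr" where
  "h_pow i r a = Abs_mfps (\<lambda>m. if set_mset m \<subseteq> {i} \<times> {1..} \<and> (\<forall>x. r dvd count m x) \<and> size m = r * a
     then 1 else 0)"

lemma mcoeff_h_var:
  "mcoeff (h_var i n) m = (if set_mset m \<subseteq> {i} \<times> {1..} \<and> size m = n then 1 else 0)"
  by (simp add: h_var_def)

lemma mcoeff_h_pow: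
  "mcoeff (h_pow i r a) m =
    (if set_mset m \<subseteq> {i} \<times> {1..} \<and> (\<forall>x. r dvd count m x) \<and> size m = r * a then 1 else 0)"
  by (simp add: h_pow_def)

lemma h_var_0 [simp]: "h_var i 0 = 1"
  by (rule mfps_eqI) (auto simp: mcoeff_h_var mcoeff_1)

lemma prod_indicator:
  "finite A \<Longrightarrow> (\<Prod>x\<in>A. if P x then 1 else (0 :: 'a :: comm_semiring_1)) = (if \<forall>x\<in>A. P x then 1 else 0)"
  by (induction A rule: finite_induct) auto

lemma set_mset_sum: "finite A \<Longrightarrow> set_mset (sum f A) = (\<Union>x\<in>A. set_mset (f x))"
  by (induction A rule: finite_induct) auto

text \<open>A coefficient of the product of the \<open>h_var i (c k)\<close> counts the splittings
  of the monomial with part sizes \<open>c\<close>. Summed over \<open>c\<close>, this becomes the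
  signed sum over all splittings, which detects the \<open>r\<close>-th powers.\<close>

lemma h_pow_eq_sum_weak_comps:
  assumes "r \<ge> 1"
  shows "h_pow i r a =
    (\<Sum>c\<in>weak_comps r (r * a). of_int (cyc_sgn r (\<lambda>k. k + c k)) * (\<Prod>k<r. h_var i (c k)))"
proof (rule mfps_eqI)
  fix m :: "(nat \<times> nat) multiset"
  let ?S = "{i} \<times> {1..} :: (nat \<times> nat) set"
  have coeff: "(\<Prod>k<r. mcoeff (h_var i (c k)) (M k)) =
      (if set_mset m \<subseteq> ?S \<and> c = (\<lambda>k. size (M k)) then 1 else 0)"
    if M: "M \<in> msplits r m" and c: "c \<in> weak_comps r (r * a)" for M c
  proof -
    have "set_mset m = (\<Union>k<r. set_mset (M k))"
      using M by (auto simp: msplits_def set_mset_sum)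
    moreover have "c = (\<lambda>k. size (M k)) \<longleftrightarrow> (\<forall>k<r. c k = size (M k))"
      using M c by (auto simp: msplits_def weak_comps_def fun_eq_iff) (metis not_le size_empty)
    ultimately show ?thesis
      unfolding mcoeff_h_var by (subst prod_indicator) auto
  qed
  have "mcoeff (\<Sum>c\<in>weak_comps r (r * a). of_int (cyc_sgn r (\<lambda>k. k + c k)) * (\<Prod>k<r. h_var i (c k))) m
    = (\<Sum>c\<in>weak_comps r (r * a). \<Sum>M\<in>msplits r m. of_int (cyc_sgn r (\<lambda>k. k + c k)) *
         (if set_mset m \<subseteq> ?S \<and> c = (\<lambda>k. size (M k)) then 1 else 0))"
    by (simp add: mcoeff_prod sum_distrib_left coeff cong: sum.cong)
  \<comment> \<open>Once the sums are exchanged, each splitting admits only one \<open>c\<close>,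
    namely its part sizes.\<close>
  also have "\<dots> = (\<Sum>M\<in>msplits r m. \<Sum>c\<in>weak_comps r (r * a).
      if c = (\<lambda>k. size (M k)) then
        (if set_mset m \<subseteq> ?S then of_int (cyc_sgn r (\<lambda>k. k + size (M k))) else 0) else 0)"
    by (subst sum.swap) (intro sum.cong, auto)
  also have "\<dots> = (\<Sum>M\<in>msplits r m. if set_mset m \<subseteq> ?S \<and> size m = r * a then
      of_int (cyc_sgn r (\<lambda>k. k + size (M k))) else 0)"
  proof (intro sum.cong refl)
    fix M assume "M \<in> msplits r m"
    then have "(\<lambda>k. size (M k)) \<in> weak_comps r (r * a) \<longleftrightarrow> size m = r * a"
      by (auto simp: msplits_def weak_comps_def)
    then show "(\<Sum>c\<in>weak_comps r (r * a). if c = (\<lambda>k. size (M k)) then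
        (if set_mset m \<subseteq> ?S then of_int (cyc_sgn r (\<lambda>k. k + size (M k))) else 0) else 0) =
        (if set_mset m \<subseteq> ?S \<and> size m = r * a then
           of_int (cyc_sgn r (\<lambda>k. k + size (M k))) else (0 :: rat))"
      by (simp add: finite_weak_comps)
  qed
  also have "\<dots> = (if set_mset m \<subseteq> ?S \<and> size m = r * a then
      of_int (\<Sum>M\<in>msplits r m. cyc_sgn r (\<lambda>k. k + size (M k))) else 0)"
    by (cases "set_mset m \<subseteq> ?S \<and> size m = r * a")
       (simp_all only: if_True if_False of_int_sum sum.neutral_const simp_thms)
  also have "\<dots> = mcoeff (h_pow i r a) m"
  proof -
    \<comment> \<open>The starting positions 0, ..., r - 1 are their own residues and increase, so
      every factor is 1.\<close>
    have "cyc_sgn r (\<lambda>k. k) = 1"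
      unfolding cyc_sgn_def by (rule prod.neutral) auto
    then show ?thesis by (simp add: sum_cyc_sgn_msplits[OF assms] mcoeff_h_pow)
  qed
  finally show "mcoeff (h_pow i r a) m = mcoeff (\<Sum>c\<in>weak_comps r (r * a).
      of_int (cyc_sgn r (\<lambda>k. k + c k)) * (\<Prod>k<r. h_var i (c k))) m" ..
qed

section \<open>Compositions in place of tuples\<close>

definition compositions :: "nat \<Rightarrow> nat list set" where
  "compositions n = {\<beta>. 0 \<notin> set \<beta> \<and> sum_list \<beta> = n}"

lemma length_le_sum_list: "0 \<notin> set \<beta> \<Longrightarrow> length \<beta> \<le> sum_list (\<beta> :: nat list)"
  by (induction \<beta>) auto

lemma finite_compositions: "finite (compositions n)"
proof (rule finite_subset)
  show "compositions n \<subseteq> {\<beta>. set \<beta> \<subseteq> {..n} \<and> length \<beta> \<le> n}"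
    using length_le_sum_list member_le_sum_list by (fastforce simp: compositions_def)
qed (simp add: finite_lists_length_le)

lemma finite_tuples: "finite {w. length w = r \<and> sum_list w = (n :: nat)}"
proof (rule finite_subset)
  show "{w. length w = r \<and> sum_list w = n} \<subseteq> {w. set w \<subseteq> {..n} \<and> length w = r}"
    using member_le_sum_list by fastforce
qed (simp add: finite_lists_length_eq)

lemma sum_list_filter_nonzero: "sum_list (filter (\<lambda>x. x \<noteq> 0) w) = sum_list (w :: nat list)"
  by (induction w) auto

lemma prod_list_filter_nonzero:
  "(\<Prod>b\<leftarrow>filter (\<lambda>x. x \<noteq> 0) w. h_var i b) = (\<Prod>b\<leftarrow>w. h_var i b)"
  by (induction w) auto

text \<open>Deleting zeros never lengthens a tuple, so for \<open>length \<beta> > r\<close> the sum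
  is empty and agrees with the default value 0.\<close>

lemma shat_comp_eq_sum:
  "shat_comp r \<beta> = (\<Sum>w | length w = r \<and> filter (\<lambda>x. x \<noteq> 0) w = \<beta>. shat_tuple r w)"
proof (cases "length \<beta> \<le> r")
  case False
  then have "{w. length w = r \<and> filter (\<lambda>x. x \<noteq> 0) w = \<beta>} = {}"
    using length_filter_le by fastforce
  with False show ?thesis by (simp only: shat_comp_def) simp
qed (simp add: shat_comp_def)

text \<open>Tuples with the same nonzero entries give the same product because
  \<open>h_var i 0 = 1\<close>; grouping them collects their signs into
  \<open>shat_comp\<close>.\<close>

lemma h_pow_eq_sum_compositions:
  assumes "r \<ge> 1"
  shows "h_pow i r a =
    (\<Sum>\<beta>\<in>compositions (r * a). of_int (shat_comp r \<beta>) * (\<Prod>b\<leftarrow>\<beta>. h_var i b))"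
proof -
  let ?W = "{w. length w = r \<and> sum_list w = r * a}"
  have "h_pow i r a = (\<Sum>w\<in>?W. of_int (shat_tuple r w) * (\<Prod>b\<leftarrow>w. h_var i b))"
    unfolding h_pow_eq_sum_weak_comps[OF assms]
  proof (rule sum.reindex_bij_witness[where
        i = "\<lambda>w k. if k < r then w ! k else 0" and j = "\<lambda>c. map c [0..<r]"])
    fix c assume c: "c \<in> weak_comps r (r * a)"
    show "(\<lambda>k. if k < r then map c [0..<r] ! k else 0) = c"
      using c by (auto simp: weak_comps_def)
    show "map c [0..<r] \<in> ?W"
      using c by (auto simp: weak_comps_def interv_sum_list_conv_sum_set_nat atLeast0LessThan)
    have "cyc_sgn r (\<lambda>k. map c [0..<r] ! k + k) = cyc_sgn r (\<lambda>k. k + c k)"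
      by (rule cyc_sgn_cong) (simp add: add.commute)
    moreover have "(\<Prod>b\<leftarrow>map c [0..<r]. h_var i b) = (\<Prod>k<r. h_var i (c k))"
      by (simp add: prod.list_conv_set_nth atLeast0LessThan)
    ultimately show "of_int (shat_tuple r (map c [0..<r])) * (\<Prod>b\<leftarrow>map c [0..<r]. h_var i b) =
        of_int (cyc_sgn r (\<lambda>k. k + c k)) * (\<Prod>k<r. h_var i (c k))"
      by (simp add: shat_tuple_eq_cyc_sgn)
  next
    fix w assume w: "w \<in> ?W"
    show "map (\<lambda>k. if k < r then w ! k else 0) [0..<r] = w"
      using w by (auto intro: nth_equalityI)
    show "(\<lambda>k. if k < r then w ! k else 0) \<in> weak_comps r (r * a)"
      using w by (auto simp: weak_comps_def sum_list_sum_nth atLeast0LessThan)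
  qed
  also have "\<dots> = (\<Sum>\<beta>\<in>compositions (r * a). \<Sum>w | w \<in> ?W \<and> filter (\<lambda>x. x \<noteq> 0) w = \<beta>.
      of_int (shat_tuple r w) * (\<Prod>b\<leftarrow>w. h_var i b))"
  proof (rule sum.group[OF finite_tuples finite_compositions, symmetric])
    show "filter (\<lambda>x. x \<noteq> 0) ` ?W \<subseteq> compositions (r * a)"
      by (auto simp: compositions_def sum_list_filter_nonzero simp del: neq0_conv)
  qed
  also have "\<dots> = (\<Sum>\<beta>\<in>compositions (r * a). of_int (shat_comp r \<beta>) * (\<Prod>b\<leftarrow>\<beta>. h_var i b))"
  proof (intro sum.cong refl)
    fix \<beta> assume \<beta>: "\<beta> \<in> compositions (r * a)"
    have "{w. w \<in> ?W \<and> filter (\<lambda>x. x \<noteq> 0) w = \<beta>} = {w. length w = r \<and> filter (\<lambda>x. x \<noteq> 0) w = \<beta>}"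
      using \<beta> sum_list_filter_nonzero by (fastforce simp: compositions_def)
    moreover have "(\<Prod>b\<leftarrow>w. h_var i b) = (\<Prod>b\<leftarrow>\<beta>. h_var i b)" if "filter (\<lambda>x. x \<noteq> 0) w = \<beta>" for w
      using that prod_list_filter_nonzero[of i w] by simp
    ultimately show "(\<Sum>w | w \<in> ?W \<and> filter (\<lambda>x. x \<noteq> 0) w = \<beta>.
        of_int (shat_tuple r w) * (\<Prod>b\<leftarrow>w. h_var i b)) = of_int (shat_comp r \<beta>) * (\<Prod>b\<leftarrow>\<beta>. h_var i b)"
      by (simp add: shat_comp_eq_sum sum_distrib_right)
  qed
  finally show ?thesis .
qed

subsection \<open>Expansion of the block series\<close>

lemma mdeg_empty [simp]: "mdeg {#} = 0"
  by (simp add: mdeg_def)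

lemma mdeg_add_mset [simp]: "mdeg (add_mset x m) = fst x + mdeg m"
  by (simp add: mdeg_def case_prod_unfold)

lemma mdeg_union [simp]: "mdeg (m + m') = mdeg m + mdeg m'"
  by (simp add: mdeg_def)

lemma mdeg_repeat_mset [simp]: "mdeg (repeat_mset r m) = r * mdeg m"
  by (induction r) auto

lemma mdeg_ge: "x \<in># m \<Longrightarrow> fst x * count m x \<le> mdeg m"
proof (induction m)
  case (add y m)
  then show ?case by (cases "x \<in># m") (auto simp: not_in_iff intro: trans_le_add2)
qed simp

abbreviation (input) var_part :: "nat \<Rightarrow> (nat \<times> nat) multiset \<Rightarrow> (nat \<times> nat) multiset" where
  "var_part i m \<equiv> filter_mset (\<lambda>x. fst x = i) m"

lemma mdeg_eq_sum:
  assumes "finite I" "fst ` set_mset m \<subseteq> I"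
  shows "mdeg m = (\<Sum>i\<in>I. i * size (var_part i m))"
  using assms(2)
proof (induction m)
  case (add x m)
  have "(\<Sum>i\<in>I. i * size (var_part i (add_mset x m))) =
      (\<Sum>i\<in>I. (if fst x = i then i else 0) + i * size (var_part i m))"
    by (rule sum.cong) auto
  also have "\<dots> = fst x + mdeg m"
    using add assms(1) by (simp add: sum.distrib)
  finally show ?case by simp
qed simp

lemma dvd_size_mset: "(\<And>x. r dvd count m x) \<Longrightarrow> r dvd size m"
  by (simp add: size_multiset_overloaded_eq dvd_sum)

text \<open>For \<open>r \<ge> 1\<close> a monomial has at most one \<open>r\<close>-th root, so the
  sum over preimages in \<open>power_vars\<close> has at most one term.\<close>

lemma mcoeff_H_block:
  assumes "r \<ge> 1"
  shows "mcoeff (H_block d r) m =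
    (if set_mset m \<subseteq> {1..} \<times> {1..} \<and> (\<forall>x. r dvd count m x) \<and> mdeg m = r * d then 1 else 0)"
proof -
  have H: "mcoeff (H_block d r) m = (\<Sum>m' | repeat_mset r m' = m.
      if set_mset m' \<subseteq> {1..} \<times> {1..} \<and> mdeg m' = d then 1 else 0)"
    by (simp add: H_block_def power_vars.rep_eq H_deg_def)
  show ?thesis
  proof (cases "\<forall>x. r dvd count m x")
    case True
    \<comment> \<open>\<open>m0\<close> is the \<open>r\<close>-th root of \<open>m\<close>.\<close>
    define m0 where "m0 = (\<Sum>x\<in>set_mset m. replicate_mset (count m x div r) x)"
    have "count m0 y = count m y div r" for y
    proof -
      have "count m0 y = (\<Sum>x\<in>set_mset m. if x = y then count m x div r else 0)"
        by (simp add: m0_def count_sum)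
      also have "\<dots> = count m y div r" by (simp add: not_in_iff)
      finally show ?thesis .
    qed
    moreover have "r dvd count m y" for y using True by blast
    ultimately have m: "repeat_mset r m0 = m" by (intro multiset_eqI) simp
    then have "{m'. repeat_mset r m' = m} = {m0}"
      using assms by (auto simp: repeat_mset_cancel1)
    moreover have "set_mset m0 = set_mset m"
      unfolding m[symmetric] by (rule set_eqI) (use assms in \<open>simp flip: count_greater_zero_iff\<close>)
    moreover have "mdeg m = r * mdeg m0" using mdeg_repeat_mset[of r m0] by (simp only: m)
    ultimately show ?thesis using True assms by (simp add: H)
  next
    case False
    then have "repeat_mset r m' \<noteq> m" for m' by (metis count_repeat_mset dvd_triv_left)
    then have "{m'. repeat_mset r m' = m} = {}" by simp
    with False show ?thesis by (simp add: H)
  qed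
qed

text \<open>Factor \<open>i\<close> involves only variables of degree \<open>i\<close>, so the only
  splitting of \<open>m\<close> that can contribute sorts its variables by degree.\<close>

lemma mcoeff_prod_disjoint_vars:
  assumes "finite I" "\<And>i m. i \<in> I \<Longrightarrow> mcoeff (f i) m \<noteq> 0 \<Longrightarrow> fst ` set_mset m \<subseteq> {i}"
  shows "mcoeff (\<Prod>i\<in>I. f i) m =
    (if fst ` set_mset m \<subseteq> I then \<Prod>i\<in>I. mcoeff (f i) (var_part i m) else 0)"
  using assms
proof (induction I arbitrary: m rule: finite_induct)
  case empty
  then show ?case by (auto simp: mcoeff_1)
next
  case (insert i I)
  let ?a = "var_part i m" and ?b = "filter_mset (\<lambda>x. fst x \<noteq> i) m"
  have IH: "mcoeff (\<Prod>i\<in>I. f i) m =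
      (if fst ` set_mset m \<subseteq> I then \<Prod>i\<in>I. mcoeff (f i) (var_part i m) else 0)" for m
    by (rule insert.IH) (use insert.prems in auto)
  have ab: "?a + ?b = m" using multiset_partition[of m "\<lambda>x. fst x = i"] by simp
  have parts: "a = ?a \<and> b = ?b"
    if "a + b = m" "mcoeff (f i) a * mcoeff (\<Prod>i\<in>I. f i) b \<noteq> 0" for a b
  proof -
    have a: "fst ` set_mset a \<subseteq> {i}" using that(2) insert.prems[of i a] by auto
    have b: "fst ` set_mset b \<subseteq> I" using that(2) by (auto simp: IH split: if_splits)
    have "var_part i a = a" "filter_mset (\<lambda>x. fst x \<noteq> i) a = {#}"
      using a by (auto simp: filter_mset_eq_conv)
    moreover have "var_part i b = {#}" "filter_mset (\<lambda>x. fst x \<noteq> i) b = b"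
      using b insert.hyps(2) by (auto simp: filter_mset_eq_conv)
    ultimately show ?thesis using that(1) by auto
  qed
  have "mcoeff (\<Prod>j\<in>insert i I. f j) m =
      (\<Sum>p\<in>{p. fst p + snd p = m}. mcoeff (f i) (fst p) * mcoeff (\<Prod>i\<in>I. f i) (snd p))"
    using insert.hyps by (simp add: mcoeff_mult case_prod_unfold)
  also have "\<dots> = (\<Sum>p\<in>{(?a, ?b)}. mcoeff (f i) (fst p) * mcoeff (\<Prod>i\<in>I. f i) (snd p))"
    by (rule sum.mono_neutral_right)
       (use ab parts finite_msplit[of m, unfolded case_prod_unfold] in \<open>auto simp del: mult_eq_0_iff\<close>)
  also have "\<dots> = mcoeff (f i) ?a * mcoeff (\<Prod>i\<in>I. f i) ?b" by simp
  also have "\<dots> = mcoeff (f i) ?a *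
      (if fst ` set_mset m \<subseteq> insert i I then \<Prod>i\<in>I. mcoeff (f i) (var_part i m) else 0)"
  proof -
    have "fst ` set_mset ?b \<subseteq> I \<longleftrightarrow> fst ` set_mset m \<subseteq> insert i I" using insert.hyps by auto
    moreover have "(\<Prod>j\<in>I. mcoeff (f j) (var_part j ?b)) = (\<Prod>j\<in>I. mcoeff (f j) (var_part j m))"
    proof (rule prod.cong[OF refl])
      fix j assume "j \<in> I"
      then have "var_part j ?b = var_part j m"
        using insert.hyps by (auto intro!: multiset_eqI)
      then show "mcoeff (f j) (var_part j ?b) = mcoeff (f j) (var_part j m)" by simp
    qed
    ultimately show ?thesis by (simp add: IH)
  qed
  also have "\<dots> = (if fst ` set_mset m \<subseteq> insert i I
      then \<Prod>j\<in>insert i I. mcoeff (f j) (var_part j m) else 0)"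
    using insert.hyps by simp
  finally show ?case .
qed

text \<open>\<open>\<alpha> i\<close> stands for the number of variables of degree \<open>i\<close>,
  with multiplicity, in a monomial of degree \<open>d\<close>; in an \<open>r\<close>-ordered type
  it is the area at \<open>i\<close> divided by \<open>r\<close>. The value outside
  \<open>{1..d}\<close> is pinned because the sum does not constrain it.\<close>

definition area_seqs :: "nat \<Rightarrow> (nat \<Rightarrow> nat) set" where
  "area_seqs d = {\<alpha>. (\<forall>i. i \<notin> {1..d} \<longrightarrow> \<alpha> i = 0) \<and> (\<Sum>i\<in>{1..d}. i * \<alpha> i) = d}"

lemma finite_area_seqs: "finite (area_seqs d)"
proof (rule finite_subset)
  show "area_seqs d \<subseteq> {\<alpha>. \<forall>i. (i \<in> {1..d} \<longrightarrow> \<alpha> i \<in> {..d}) \<and> (i \<notin> {1..d} \<longrightarrow> \<alpha> i = 0)}"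
  proof clarify
    fix \<alpha> i assume \<alpha>: "\<alpha> \<in> area_seqs d"
    have "\<alpha> i \<le> d" if "i \<in> {1..d}"
    proof -
      have "\<alpha> i \<le> i * \<alpha> i" using that by simp
      also have "\<dots> \<le> d" using member_le_sum[of i "{1..d}" "\<lambda>i. i * \<alpha> i"] that \<alpha>
        by (simp add: area_seqs_def)
      finally show ?thesis .
    qed
    with \<alpha> show "(i \<in> {1..d} \<longrightarrow> \<alpha> i \<in> {..d}) \<and> (i \<notin> {1..d} \<longrightarrow> \<alpha> i = 0)"
      by (auto simp: area_seqs_def)
  qed
  show "finite {\<alpha>. \<forall>i. (i \<in> {1..d} \<longrightarrow> \<alpha> i \<in> {..d}) \<and> (i \<notin> {1..d} \<longrightarrow> \<alpha> i = (0 :: nat))}"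
    by (rule finite_set_of_finite_funs) auto
qed

text \<open>Each monomial of \<open>H_block d r\<close> occurs in exactly one of the products, the
  one whose \<open>\<alpha>\<close> gives for each degree the number of its variables divided by
  \<open>r\<close>.\<close>

lemma H_block_eq_sum_area_seqs:
  assumes r: "r \<ge> 1"
  shows "H_block d r = (\<Sum>\<alpha>\<in>area_seqs d. \<Prod>i\<in>{1..d}. h_pow i r (\<alpha> i))"
proof (rule mfps_eqI)
  fix m :: "(nat \<times> nat) multiset"
  let ?good = "set_mset m \<subseteq> {1..} \<times> {1..} \<and> (\<forall>x. r dvd count m x) \<and> mdeg m = r * d"
  \<comment> \<open>The only candidate for \<open>\<alpha>\<close>, read off from
    \<open>m\<close>.\<close>
  define \<beta> where "\<beta> = (\<lambda>i. if i \<in> {1..d} then size (var_part i m) div r else 0)"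
  \<comment> \<open>Every variable of \<open>m\<close> occurs at least \<open>r\<close> times, so
    its degree is at most \<open>d\<close>.\<close>
  have range: "fst ` set_mset m \<subseteq> {1..d}" if good: ?good
  proof clarify
    fix i j assume x: "(i, j) \<in># m"
    then have "r \<le> count m (i, j)" using good by (auto intro: dvd_imp_le)
    then have "i * r \<le> i * count m (i, j)" by simp
    also have "\<dots> \<le> r * d" using mdeg_ge[OF x] good by simp
    finally show "fst (i, j) \<in> {1..d}" using good x r by (auto simp: mult.commute)
  qed
  have size: "size (var_part i m) = r * (size (var_part i m) div r)" if good: ?good for i
  proof -
    have "r dvd size (var_part i m)" using good by (intro dvd_size_mset) auto
    then show ?thesis by simp
  qed
  have coeff: "mcoeff (\<Prod>i\<in>{1..d}. h_pow i r (\<alpha> i)) m = (if ?good \<and> \<alpha> = \<beta> then 1 else 0)"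
    if \<alpha>: "\<alpha> \<in> area_seqs d" for \<alpha>
  proof -
    let ?C = "\<lambda>i. set_mset (var_part i m) \<subseteq> {i} \<times> {1..} \<and> (\<forall>x. r dvd count (var_part i m) x) \<and>
        size (var_part i m) = r * \<alpha> i"
    have "mcoeff (\<Prod>i\<in>{1..d}. h_pow i r (\<alpha> i)) m =
        (if fst ` set_mset m \<subseteq> {1..d} then \<Prod>i\<in>{1..d}. mcoeff (h_pow i r (\<alpha> i)) (var_part i m) else 0)"
      by (rule mcoeff_prod_disjoint_vars) (auto simp: mcoeff_h_pow split: if_splits)
    also have "\<dots> = (if fst ` set_mset m \<subseteq> {1..d} \<and> (\<forall>i\<in>{1..d}. ?C i) then 1 else 0)"
      unfolding mcoeff_h_pow by (subst prod_indicator) auto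
    also have "fst ` set_mset m \<subseteq> {1..d} \<and> (\<forall>i\<in>{1..d}. ?C i) \<longleftrightarrow> ?good \<and> \<alpha> = \<beta>"
    proof (intro iffI)
      assume L: "fst ` set_mset m \<subseteq> {1..d} \<and> (\<forall>i\<in>{1..d}. ?C i)"
      have "x \<in> {1..} \<times> {1..} \<and> r dvd count m x" if "x \<in># m" for x
      proof -
        have i: "fst x \<in> {1..d}" using L that by auto
        with L have "?C (fst x)" by blast
        moreover have "x \<in># var_part (fst x) m" using that by simp
        ultimately have "x \<in> {fst x} \<times> {1..}" "r dvd count (var_part (fst x) m) x" by blast+
        with i show ?thesis by (cases x) auto
      qed
      then have "set_mset m \<subseteq> {1..} \<times> {1..}" "\<forall>x. r dvd count m x"
        by (blast, metis dvd_0_right not_in_iff)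
      moreover have "mdeg m = (\<Sum>i\<in>{1..d}. r * (i * \<alpha> i))"
        using L by (subst mdeg_eq_sum[of "{1..d}"]) (auto intro!: sum.cong)
      then have "mdeg m = r * d"
        using \<alpha> by (simp add: area_seqs_def sum_distrib_left[symmetric])
      moreover have "\<alpha> = \<beta>"
      proof
        fix i show "\<alpha> i = \<beta> i"
          using L \<alpha> r by (cases "i \<in> {1..d}") (auto simp: \<beta>_def area_seqs_def)
      qed
      ultimately show "?good \<and> \<alpha> = \<beta>" by blast
    next
      assume R: "?good \<and> \<alpha> = \<beta>"
      then have "?C i" if "i \<in> {1..d}" for i
        using that size[of i] by (auto simp: \<beta>_def)
      then show "fst ` set_mset m \<subseteq> {1..d} \<and> (\<forall>i\<in>{1..d}. ?C i)" using range R by blast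
    qed
    finally show ?thesis .
  qed
  have "\<beta> \<in> area_seqs d" if good: ?good
  proof -
    have "r * (\<Sum>i\<in>{1..d}. i * \<beta> i) = (\<Sum>i\<in>{1..d}. i * size (var_part i m))"
      unfolding sum_distrib_left
    proof (rule sum.cong[OF refl])
      fix i assume "i \<in> {1..d}"
      then show "r * (i * \<beta> i) = i * size (var_part i m)"
        by (subst size[OF good]) (simp add: \<beta>_def)
    qed
    also have "\<dots> = r * d" using mdeg_eq_sum[OF _ range[OF good]] good by simp
    finally show ?thesis using r by (auto simp: area_seqs_def \<beta>_def)
  qed
  then have delta: "(\<Sum>\<alpha>\<in>area_seqs d. if ?good \<and> \<alpha> = \<beta> then 1 else 0) = (if ?good then 1 else (0 :: rat))"
    by (cases ?good) (simp_all only: simp_thms if_False sum.neutral_const sum.delta finite_area_seqs if_True)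
  show "mcoeff (H_block d r) m = mcoeff (\<Sum>\<alpha>\<in>area_seqs d. \<Prod>i\<in>{1..d}. h_pow i r (\<alpha> i)) m"
    unfolding mcoeff_H_block[OF r] mcoeff_sum delta[symmetric]
    by (rule sum.cong[OF refl], rule coeff[symmetric])
qed

section \<open>Ordered types as choices of compositions\<close>

lemma shat_comp_Nil [simp]: "shat_comp r [] = 1"
proof -
  have "{w. length w = r \<and> filter (\<lambda>x. x \<noteq> 0) w = []} = {replicate r (0 :: nat)}"
    by (auto simp: filter_empty_conv intro!: replicate_eqI)
  moreover have "shat_tuple r (replicate r 0) = 1"
    unfolding shat_tuple_eq_cyc_sgn cyc_sgn_def by (rule prod.neutral) auto
  ultimately show ?thesis by (simp add: shat_comp_eq_sum)
qed

text \<open>A nonempty entry at \<open>i\<close> has positive area divisible by \<open>r\<close>, so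
  it takes up at least \<open>i * r\<close> of the total \<open>d * r\<close>.\<close>

lemma OTyp_supp:
  assumes "\<delta> \<in> OTyp_div r (d * r)" "r \<ge> 1"
  shows "otype_supp \<delta> \<subseteq> {1..d}"
proof
  fix i assume i: "i \<in> otype_supp \<delta>"
  have "i * r \<le> i * sum_list (\<delta> i)"
  proof -
    have "hd (\<delta> i) \<in> set (\<delta> i)" using i by (simp add: otype_supp_def)
    moreover from this assms have "hd (\<delta> i) > 0"
      by (metis (mono_tags, lifting) OTyp_div_def OTyp_def mem_Collect_eq neq0_conv)
    ultimately have "sum_list (\<delta> i) > 0" using member_le_sum_list by fastforce
    moreover have "r dvd sum_list (\<delta> i)" using assms by (simp add: OTyp_div_def)
    ultimately show ?thesis by (simp add: dvd_imp_le)
  qed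
  also have "\<dots> \<le> (\<Sum>i\<in>otype_supp \<delta>. i * sum_list (\<delta> i))"
    by (rule member_le_sum) (use i assms in \<open>auto simp: OTyp_div_def OTyp_def\<close>)
  also have "\<dots> = d * r" using assms by (simp add: OTyp_div_def OTyp_def)
  finally have "i \<le> d" using assms by simp
  moreover have "i \<noteq> 0"
    using i assms by (cases "i = 0") (auto simp: OTyp_div_def OTyp_def otype_supp_def)
  ultimately show "i \<in> {1..d}" by simp
qed

text \<open>This is the form in which expanding a product of sums delivers the
  \<open>r\<close>-ordered types: an area sequence and one composition per index.\<close>

lemma OTyp_div_iff:
  assumes r: "r \<ge> 1"
  shows "\<delta> \<in> OTyp_div r (d * r) \<longleftrightarrow> (\<forall>i. i \<notin> {1..d} \<longrightarrow> \<delta> i = []) \<and>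
    (\<exists>\<alpha>\<in>area_seqs d. \<forall>i\<in>{1..d}. \<delta> i \<in> compositions (r * \<alpha> i))"
proof (intro iffI conjI)
  assume \<delta>: "\<delta> \<in> OTyp_div r (d * r)"
  have supp: "otype_supp \<delta> \<subseteq> {1..d}" by (rule OTyp_supp[OF \<delta> r])
  then show "\<forall>i. i \<notin> {1..d} \<longrightarrow> \<delta> i = []" by (auto simp: otype_supp_def)
  define \<alpha> where "\<alpha> = (\<lambda>i. sum_list (\<delta> i) div r)"
  have sum: "sum_list (\<delta> i) = r * \<alpha> i" for i using \<delta> by (simp add: \<alpha>_def OTyp_div_def)
  have "r * (\<Sum>i\<in>{1..d}. i * \<alpha> i) = (\<Sum>i\<in>{1..d}. i * sum_list (\<delta> i))"
    by (simp add: sum sum_distrib_left algebra_simps)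
  also have "\<dots> = (\<Sum>i\<in>otype_supp \<delta>. i * sum_list (\<delta> i))"
    by (rule sum.mono_neutral_right) (use supp in \<open>auto simp: otype_supp_def\<close>)
  also have "\<dots> = d * r" using \<delta> by (simp add: OTyp_div_def OTyp_def)
  finally have "\<alpha> \<in> area_seqs d"
    using \<open>\<forall>i. i \<notin> {1..d} \<longrightarrow> \<delta> i = []\<close> r by (simp add: area_seqs_def \<alpha>_def del: atLeastAtMost_iff)
  moreover have "\<forall>i. \<delta> i \<in> compositions (r * \<alpha> i)"
    using \<delta> sum by (auto simp: compositions_def OTyp_div_def OTyp_def)
  ultimately show "\<exists>\<alpha>\<in>area_seqs d. \<forall>i\<in>{1..d}. \<delta> i \<in> compositions (r * \<alpha> i)" by blast
next
  assume "(\<forall>i. i \<notin> {1..d} \<longrightarrow> \<delta> i = []) \<and>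
    (\<exists>\<alpha>\<in>area_seqs d. \<forall>i\<in>{1..d}. \<delta> i \<in> compositions (r * \<alpha> i))"
  then obtain \<alpha> where 0: "\<forall>i. i \<notin> {1..d} \<longrightarrow> \<delta> i = []" and \<alpha>: "\<alpha> \<in> area_seqs d"
    and c: "\<forall>i\<in>{1..d}. \<delta> i \<in> compositions (r * \<alpha> i)" by blast
  have supp: "otype_supp \<delta> \<subseteq> {1..d}" using 0 by (auto simp: otype_supp_def)
  have "(\<Sum>i\<in>otype_supp \<delta>. i * sum_list (\<delta> i)) = (\<Sum>i\<in>{1..d}. i * sum_list (\<delta> i))"
    by (rule sum.mono_neutral_left) (use supp in \<open>auto simp: otype_supp_def\<close>)
  also have "\<dots> = (\<Sum>i\<in>{1..d}. r * (i * \<alpha> i))"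
    using c by (intro sum.cong) (auto simp: compositions_def)
  also have "\<dots> = d * r"
    using \<alpha> by (simp add: area_seqs_def sum_distrib_left[symmetric])
  finally have sum: "(\<Sum>i\<in>otype_supp \<delta>. i * sum_list (\<delta> i)) = d * r" .
  have "0 \<notin> set (\<delta> i) \<and> r dvd sum_list (\<delta> i)" for i
    using 0 c by (cases "i \<in> {1..d}") (auto simp: compositions_def)
  moreover have "finite (otype_supp \<delta>)" using supp finite_subset by blast
  moreover have "\<delta> 0 = []" using 0 by simp
  ultimately show "\<delta> \<in> OTyp_div r (d * r)" using sum by (simp add: OTyp_div_def OTyp_def)
qed

lemma H_block_expansion:
  assumes r: "r \<ge> 1"
  shows "H_block d r = (\<Sum>\<delta>\<in>OTyp_div r (d * r). of_int (shat r \<delta>) * h_otimes \<delta>)"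
proof -
  let ?t = "\<lambda>i \<beta>. of_int (shat_comp r \<beta>) * (\<Prod>b\<leftarrow>\<beta>. h_var i b) :: psr"
  have "H_block d r = (\<Sum>\<alpha>\<in>area_seqs d. \<Prod>i\<in>{1..d}. \<Sum>\<beta>\<in>compositions (r * \<alpha> i). ?t i \<beta>)"
    by (simp add: H_block_eq_sum_area_seqs[OF r] h_pow_eq_sum_compositions[OF r])
  also have "\<dots> = (\<Sum>\<alpha>\<in>area_seqs d. \<Sum>g\<in>PiE {1..d} (\<lambda>i. compositions (r * \<alpha> i)). \<Prod>i\<in>{1..d}. ?t i (g i))"
    by (intro sum.cong refl prod_sum_PiE) (auto simp: finite_compositions)
  also have "\<dots> = (\<Sum>(\<alpha>, g)\<in>Sigma (area_seqs d) (\<lambda>\<alpha>. PiE {1..d} (\<lambda>i. compositions (r * \<alpha> i))).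
      \<Prod>i\<in>{1..d}. ?t i (g i))"
    by (rule sum.Sigma) (auto simp: finite_area_seqs finite_compositions intro!: finite_PiE)
  also have "\<dots> = (\<Sum>\<delta>\<in>OTyp_div r (d * r). of_int (shat r \<delta>) * h_otimes \<delta>)"
  \<comment> \<open>\<open>\<alpha>\<close> is recovered from the areas of \<open>\<delta>\<close>.
    Outside \<open>{1..d}\<close> members of \<open>PiE\<close> are \<open>undefined\<close> while
    ordered types are \<open>[]\<close>, hence the translation in both directions.\<close>
  proof (rule sum.reindex_bij_witness[where
        i = "\<lambda>\<delta>. (\<lambda>i. sum_list (\<delta> i) div r, restrict \<delta> {1..d})" and
        j = "\<lambda>(\<alpha>, g) i. if i \<in> {1..d} then g i else []"])
    fix p assume p: "p \<in> Sigma (area_seqs d) (\<lambda>\<alpha>. PiE {1..d} (\<lambda>i. compositions (r * \<alpha> i)))"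
    obtain \<alpha> g where [simp]: "p = (\<alpha>, g)" by (cases p)
    have \<alpha>: "\<alpha> \<in> area_seqs d" and g: "g \<in> PiE {1..d} (\<lambda>i. compositions (r * \<alpha> i))" using p by auto
    let ?\<delta> = "\<lambda>i. if i \<in> {1..d} then g i else []"
    have gi: "g i \<in> compositions (r * \<alpha> i)" if "i \<in> {1..d}" for i using g that by auto
    have "sum_list (?\<delta> i) div r = \<alpha> i" for i
      using gi[of i] \<alpha> r by (cases "i \<in> {1..d}") (auto simp: compositions_def area_seqs_def)
    moreover have "restrict ?\<delta> {1..d} = g"
      using g by (auto simp: fun_eq_iff PiE_def extensional_def)
    ultimately show "(\<lambda>\<delta>. (\<lambda>i. sum_list (\<delta> i) div r, restrict \<delta> {1..d}))
        ((\<lambda>(\<alpha>, g) i. if i \<in> {1..d} then g i else []) p) = p" by simp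
    show "(\<lambda>(\<alpha>, g) i. if i \<in> {1..d} then g i else []) p \<in> OTyp_div r (d * r)"
      unfolding OTyp_div_iff[OF r] by (intro conjI bexI[OF _ \<alpha>]) (use gi in auto)
    have supp: "otype_supp ?\<delta> \<subseteq> {1..d}" by (auto simp: otype_supp_def)
    have "of_int (shat r ?\<delta>) * h_otimes ?\<delta> = (\<Prod>i\<in>otype_supp ?\<delta>. ?t i (?\<delta> i))"
      by (simp add: shat_def h_otimes_def prod.distrib)
    \<comment> \<open>Indices outside the support contribute 1, by \<open>shat_comp_Nil\<close> and
      the empty product.\<close>
    also have "\<dots> = (\<Prod>i\<in>{1..d}. ?t i (?\<delta> i))"
      by (rule prod.mono_neutral_left) (use supp in \<open>auto simp: otype_supp_def\<close>)
    also have "\<dots> = (\<Prod>i\<in>{1..d}. ?t i (g i))" by (rule prod.cong) auto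
    finally show "of_int (shat r ((\<lambda>(\<alpha>, g) i. if i \<in> {1..d} then g i else []) p)) *
        h_otimes ((\<lambda>(\<alpha>, g) i. if i \<in> {1..d} then g i else []) p) =
        (case p of (\<alpha>, g) \<Rightarrow> \<Prod>i\<in>{1..d}. ?t i (g i))" by simp
  next
    fix \<delta> assume \<delta>: "\<delta> \<in> OTyp_div r (d * r)"
    obtain \<alpha> where 0: "\<forall>i. i \<notin> {1..d} \<longrightarrow> \<delta> i = []" and \<alpha>: "\<alpha> \<in> area_seqs d"
      and c: "\<forall>i\<in>{1..d}. \<delta> i \<in> compositions (r * \<alpha> i)"
      using \<delta> unfolding OTyp_div_iff[OF r] by blast
    have "sum_list (\<delta> i) div r = \<alpha> i" for i
      using 0 c \<alpha> r by (cases "i \<in> {1..d}") (auto simp: compositions_def area_seqs_def)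
    then show "(\<lambda>i. sum_list (\<delta> i) div r, restrict \<delta> {1..d}) \<in>
        Sigma (area_seqs d) (\<lambda>\<alpha>. PiE {1..d} (\<lambda>i. compositions (r * \<alpha> i)))"
      using \<alpha> c by (simp add: PiE_def)
    show "(\<lambda>(\<alpha>, g) i. if i \<in> {1..d} then g i else [])
        (\<lambda>i. sum_list (\<delta> i) div r, restrict \<delta> {1..d}) = \<delta>"
      using 0 by (auto simp: fun_eq_iff)
  qed
  finally show ?thesis .
qed

subsection \<open>Linear independence\<close>

lemma mfps_scale_mult_left: "mfps_scale c f * g = mfps_scale c (f * g)"
  by (rule mfps_eqI) (simp add: mcoeff_mult sum_distrib_left case_prod_unfold mult.assoc)

lemma mfps_scale_mult_right: "f * mfps_scale c g = mfps_scale c (f * g)"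
  using mfps_scale_mult_left[of c g f] by (simp add: mult.commute)

text \<open>Types are replaced by their multisets of blocks, so that multiplying the series
  corresponds to adding multisets.\<close>

definition h_blocks :: "(nat \<times> nat) multiset \<Rightarrow> psr" where
  "h_blocks B = (\<Prod>p\<in>#B. h_var (fst p) (snd p))"

definition block_weight :: "(nat \<times> nat) multiset \<Rightarrow> nat" where
  "block_weight B = (\<Sum>p\<in>#B. fst p * snd p)"

text \<open>The multiset counterpart of \<open>Typ n\<close>, onto which \<open>blocks\<close> maps
  it.\<close>

definition block_msets :: "nat \<Rightarrow> (nat \<times> nat) multiset set" where
  "block_msets n = {B. (\<forall>p\<in>#B. fst p \<ge> 1 \<and> snd p \<ge> 1) \<and> block_weight B = n}"

lemma h_blocks_union [simp]: "h_blocks (B + C) = h_blocks B * h_blocks C"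
  by (simp add: h_blocks_def)

lemma block_weight_union [simp]: "block_weight (B + C) = block_weight B + block_weight C"
  by (simp add: block_weight_def)

lemma block_msets_union:
  "B \<in> block_msets m \<Longrightarrow> C \<in> block_msets n \<Longrightarrow> B + C \<in> block_msets (m + n)"
  by (auto simp: block_msets_def)

lemma finite_block_msets: "finite (block_msets n)"
proof (rule finite_subset)
  show "block_msets n \<subseteq> mset ` {xs. set xs \<subseteq> {..n} \<times> {..n} \<and> length xs \<le> n}"
  proof
    fix B assume B: "B \<in> block_msets n"
    have "size B \<le> block_weight B \<and> (\<forall>p\<in>#B. fst p \<le> block_weight B \<and> snd p \<le> block_weight B)"
      if "\<forall>p\<in>#B. fst p \<ge> 1 \<and> snd p \<ge> 1"
      using that
    proof (induction B)
      case (add p B)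
      obtain v where v: "v = fst p * snd p" "1 \<le> v" "fst p \<le> v" "snd p \<le> v"
        using add.prems by auto
      have w: "block_weight (add_mset p B) = v + block_weight B"
        by (simp add: block_weight_def v(1))
      have IH: "size B \<le> block_weight B"
          "q \<in># B \<Longrightarrow> fst q \<le> block_weight B \<and> snd q \<le> block_weight B" for q
        using add by auto
      show ?case unfolding w using v(2-) IH by (auto simp: trans_le_add1 trans_le_add2)
    qed simp
    then have "set_mset B \<subseteq> {..n} \<times> {..n}" "size B \<le> n"
      using B by (auto simp: block_msets_def)
    moreover obtain xs where "mset xs = B" using ex_mset by blast
    ultimately show "B \<in> mset ` {xs. set xs \<subseteq> {..n} \<times> {..n} \<and> length xs \<le> n}"
      by (auto intro!: image_eqI[of _ _ xs])
  qed
qed (simp add: finite_lists_length_le)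

text \<open>\<open>h_pow d r 1\<close> is the power sum \<open>p\<^sub>r(x\<^sub>d\<^sub>1, x\<^sub>d\<^sub>2, \<dots>)\<close>.\<close>

definition p_blocks :: "(nat \<times> nat) multiset \<Rightarrow> psr" where
  "p_blocks B = (\<Prod>p\<in>#B. h_pow (fst p) (snd p) 1)"

text \<open>All exponents are multiples of \<open>r\<close> and their total is \<open>r\<close>,
  which leaves room for a single variable.\<close>

lemma mcoeff_power_sum_nonzero:
  assumes "mcoeff (h_pow d r 1) a \<noteq> 0" "r \<ge> 1"
  obtains j where "j \<ge> 1" "a = replicate_mset r (d, j)"
proof -
  from assms have a: "set_mset a \<subseteq> {d} \<times> {1..}" "\<forall>x. r dvd count a x" "size a = r"
    by (auto simp: mcoeff_h_pow split: if_splits)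
  then have "a \<noteq> {#}" using assms(2) by auto
  then obtain x where x: "x \<in># a" by blast
  then obtain j where j: "x = (d, j)" "j \<ge> 1" using a(1) by auto
  have "r \<le> count a x" by (rule dvd_imp_le) (use a(2) x in \<open>blast, simp\<close>)
  then have "replicate_mset r x \<subseteq># a" by (simp add: count_le_replicate_mset_subset_eq)
  then have "a = replicate_mset r x"
    using a(3) mset_subset_size[of "replicate_mset r x" a] by (metis less_irrefl size_replicate_mset subset_mset.order_iff_strict)
  with j that show ?thesis by blast
qed

lemma mcoeff_power_sum_replicate: "j \<ge> 1 \<Longrightarrow> mcoeff (h_pow d r 1) (replicate_mset r (d, j)) = 1"
  by (auto simp: mcoeff_h_pow)

text \<open>Each variable becomes a block made of its degree and its exponent. Products of power
  sums are triangular with respect to this shape.\<close>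

definition mshape :: "(nat \<times> nat) multiset \<Rightarrow> (nat \<times> nat) multiset" where
  "mshape m = image_mset (\<lambda>x. (fst x, count m x)) (mset_set (set_mset m))"

lemma size_mshape: "size (mshape m) = card (set_mset m)"
  by (simp add: mshape_def)

lemma mshape_new_var:
  assumes "(d, j) \<notin># m" "r \<ge> 1"
  shows "mshape (replicate_mset r (d, j) + m) = add_mset (d, r) (mshape m)"
proof -
  have s: "set_mset (replicate_mset r (d, j) + m) = insert (d, j) (set_mset m)"
    using assms by auto
  have "image_mset (\<lambda>x. (fst x, count (replicate_mset r (d, j) + m) x)) (mset_set (set_mset m)) =
      mshape m"
    unfolding mshape_def by (rule image_mset_cong) (use assms in auto)
  then show ?thesis
    unfolding mshape_def s using assms by (simp add: not_in_iff)
qed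

lemma p_blocks_add_mset: "p_blocks (add_mset p B) = h_pow (fst p) (snd p) 1 * p_blocks B"
  by (simp add: p_blocks_def)

text \<open>The powers are multiplied one at a time. A power of a new variable adds its block to the
  shape; a power of a variable already present leaves the number of blocks unchanged. Hence the
  maximal number is reached only with distinct variables, and then the shape is
  \<open>B\<close>.\<close>

lemma mcoeff_p_blocks_triangular:
  assumes "\<forall>p\<in>#B. snd p \<ge> 1" "mcoeff (p_blocks B) m \<noteq> 0"
  shows "size (mshape m) \<le> size B" "size (mshape m) = size B \<Longrightarrow> mshape m = B"
proof -
  have "size (mshape m) \<le> size B \<and> (size (mshape m) = size B \<longrightarrow> mshape m = B)"
    using assms
  proof (induction B arbitrary: m)
    case empty
    then have "m = {#}" by (auto simp: p_blocks_def mcoeff_1 split: if_splits)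
    then show ?case by (simp add: mshape_def)
  next
    case (add p B)
    obtain d r where p: "p = (d, r)" by (cases p)
    from add.prems(2) have
      "(\<Sum>(a, b)\<in>{(a, b). a + b = m}. mcoeff (h_pow d r 1) a * mcoeff (p_blocks B) b) \<noteq> 0"
      by (simp add: p_blocks_add_mset mcoeff_mult p)
    then obtain q where "q \<in> {(a, b). a + b = m}"
      "(case q of (a, b) \<Rightarrow> mcoeff (h_pow d r 1) a * mcoeff (p_blocks B) b) \<noteq> 0"
      by (rule sum.not_neutral_contains_not_neutral)
    then obtain a b where ab: "a + b = m" "mcoeff (h_pow d r 1) a \<noteq> 0" "mcoeff (p_blocks B) b \<noteq> 0"
      by auto
    have r: "r \<ge> 1" using add.prems p by auto
    obtain j where j: "j \<ge> 1" "a = replicate_mset r (d, j)"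
      using mcoeff_power_sum_nonzero[OF ab(2) r] by blast
    have IH: "size (mshape b) \<le> size B" "size (mshape b) = size B \<Longrightarrow> mshape b = B"
      using add.IH[OF _ ab(3)] add.prems by auto
    show ?case
    proof (cases "(d, j) \<in># b")
      case True
      then have "set_mset m = set_mset b" using ab(1) j by (auto split: if_splits)
      then have "size (mshape m) = size (mshape b)" by (simp add: size_mshape)
      then show ?thesis using IH by simp
    next
      case False
      then have "mshape m = add_mset p (mshape b)"
        using mshape_new_var[OF False r] ab(1) j p by auto
      then show ?thesis using IH by auto
    qed
  qed
  then show "size (mshape m) \<le> size B" "size (mshape m) = size B \<Longrightarrow> mshape m = B" by auto
qed

lemma mcoeff_p_blocks_nonneg: "mcoeff (p_blocks B) m \<ge> 0"
proof (induction B arbitrary: m)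
  case (add p B)
  show ?case unfolding p_blocks_add_mset mcoeff_mult
    by (rule sum_nonneg) (auto simp: add.IH mcoeff_h_pow)
qed (simp add: p_blocks_def mcoeff_1)

text \<open>Giving every block a fresh variable realises the shape \<open>B\<close>, and nonnegative
  coefficients rule out cancellation.\<close>

lemma mcoeff_p_blocks_diagonal:
  assumes "\<forall>p\<in>#B. snd p \<ge> 1"
  shows "\<exists>m. mshape m = B \<and> mcoeff (p_blocks B) m > 0"
  using assms
proof (induction B)
  case empty
  show ?case by (rule exI[of _ "{#}"]) (simp add: mshape_def p_blocks_def mcoeff_1)
next
  case (add p B)
  then obtain m where m: "mshape m = B" "mcoeff (p_blocks B) m > 0" by auto
  obtain d r where p: "p = (d, r)" by (cases p)
  have r: "r \<ge> 1" using add.prems p by auto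
  \<comment> \<open>Excluding 0 as well ensures \<open>j \<ge> 1\<close>, as required of a
    variable.\<close>
  obtain j where j: "j \<notin> insert 0 (snd ` set_mset m)"
    using ex_new_if_finite[of "insert 0 (snd ` set_mset m)"] by auto
  then have new: "(d, j) \<notin># m" "j \<ge> 1" by force+
  let ?a = "replicate_mset r (d, j)"
  let ?f = "\<lambda>(a, b). mcoeff (h_pow d r 1) a * mcoeff (p_blocks B) b"
  have "0 < ?f (?a, m)" using m new mcoeff_power_sum_replicate by simp
  also have "?f (?a, m) \<le> (\<Sum>p\<in>{(a, b). a + b = ?a + m}. ?f p)"
    by (rule member_le_sum)
       (auto simp: mcoeff_p_blocks_nonneg finite_msplit mcoeff_h_pow)
  finally have "mcoeff (p_blocks (add_mset p B)) (?a + m) > 0"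
    by (simp add: p_blocks_add_mset mcoeff_mult p)
  then show ?case using mshape_new_var[OF new(1) r] m(1) p by auto
qed

text \<open>Among the multisets with nonzero coefficient, \<open>B0\<close> has the most blocks. At
  a monomial of shape \<open>B0\<close> triangularity lets no other term contribute. Indexing by
  multisets rather than by series makes injectivity of \<open>p_blocks\<close> a consequence
  too.\<close>

lemma p_blocks_independent:
  assumes "finite S" "\<forall>B\<in>S. \<forall>p\<in>#B. snd p \<ge> 1"
    and "(\<Sum>B\<in>S. mfps_scale (c B) (p_blocks B)) = 0" "B \<in> S"
  shows "c B = 0"
proof (rule ccontr)
  assume "c B \<noteq> 0"
  let ?N = "{B \<in> S. c B \<noteq> 0}"
  have "finite ?N" "?N \<noteq> {}" using assms \<open>c B \<noteq> 0\<close> by auto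
  then have "Max (size ` ?N) \<in> size ` ?N" by simp
  then obtain B0 where B0: "B0 \<in> ?N" "size B0 = Max (size ` ?N)" by auto
  have max: "size B \<le> size B0" if "B \<in> ?N" for B
    unfolding B0(2) using that \<open>finite ?N\<close> by simp
  obtain m where m: "mshape m = B0" "mcoeff (p_blocks B0) m > 0"
    using mcoeff_p_blocks_diagonal[of B0] assms(2) B0(1) by auto
  have "c B * mcoeff (p_blocks B) m = 0" if "B \<in> S - {B0}" for B
  proof (rule ccontr)
    assume *: "c B * mcoeff (p_blocks B) m \<noteq> 0"
    then have "size B \<le> size B0" using max[of B] that by simp
    moreover have "size B0 \<le> size B" "size B0 = size B \<Longrightarrow> B0 = B"
      using mcoeff_p_blocks_triangular[of B m] assms(2) that * m(1) by auto
    ultimately show False using that by auto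
  qed
  then have "(\<Sum>B\<in>S - {B0}. c B * mcoeff (p_blocks B) m) = 0" by (intro sum.neutral) blast
  then have "(\<Sum>B\<in>S. c B * mcoeff (p_blocks B) m) = c B0 * mcoeff (p_blocks B0) m"
    using B0(1) assms(1) sum.remove[of S B0 "\<lambda>B. c B * mcoeff (p_blocks B) m"] by simp
  moreover have "(\<Sum>B\<in>S. c B * mcoeff (p_blocks B) m) = mcoeff (\<Sum>B\<in>S. mfps_scale (c B) (p_blocks B)) m"
    by simp
  ultimately show False using assms(3) B0(1) m(2) by simp
qed

lemma inj_on_p_blocks: "inj_on p_blocks (block_msets n)"
proof (rule inj_onI, rule ccontr)
  fix B C assume BC: "B \<in> block_msets n" "C \<in> block_msets n" "p_blocks B = p_blocks C" "B \<noteq> C"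
  \<comment> \<open>A coincidence would be the relation
    \<open>p_blocks B - p_blocks C = 0\<close>.\<close>
  let ?c = "\<lambda>X. if X = B then 1 else (- 1 :: rat)"
  have "?c B = 0"
    by (rule p_blocks_independent[where S = "{B, C}"]) (use BC in \<open>auto simp: block_msets_def\<close>)
  then show False by simp
qed

lemma independent_p_blocks: "mfps.independent (p_blocks ` block_msets n)"
proof
  assume "mfps.dependent (p_blocks ` block_msets n)"
  then obtain u where u: "\<exists>v\<in>p_blocks ` block_msets n. u v \<noteq> 0"
      "(\<Sum>v\<in>p_blocks ` block_msets n. mfps_scale (u v) v) = 0"
    using mfps.dependent_finite[of "p_blocks ` block_msets n"] finite_block_msets by auto
  have "(\<Sum>B\<in>block_msets n. mfps_scale (u (p_blocks B)) (p_blocks B)) = 0"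
    using u(2) by (simp add: sum.reindex[OF inj_on_p_blocks])
  then have "u (p_blocks B) = 0" if "B \<in> block_msets n" for B
    using p_blocks_independent[of "block_msets n" "\<lambda>B. u (p_blocks B)"] that finite_block_msets
    by (auto simp: block_msets_def)
  then show False using u(1) by auto
qed

section \<open>The span of the products of complete homogeneous functions\<close>

abbreviation h_span :: "nat \<Rightarrow> psr set" where
  "h_span n \<equiv> mfps.span (h_blocks ` block_msets n)"

text \<open>By bilinearity it suffices to multiply generators, whose block multisets add up.\<close>

lemma h_span_mult:
  assumes "f \<in> h_span m" "g \<in> h_span n"
  shows "f * g \<in> h_span (m + n)"
proof -
  have 1: "h_blocks B * g \<in> h_span (m + n)" if "B \<in> block_msets m" for B
    using assms(2)
  proof (induction rule: mfps.span_induct)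
    case base
    show ?case
      by (auto simp: mfps.subspace_def distrib_left mfps_scale_mult_right
          intro: mfps.span_zero mfps.span_add mfps.span_scale)
  next
    case (step g)
    then obtain C where "C \<in> block_msets n" "g = h_blocks C" by auto
    then have "h_blocks B * g = h_blocks (B + C)" "B + C \<in> block_msets (m + n)"
      using that by (auto intro: block_msets_union)
    then show ?case by (simp del: h_blocks_union add: mfps.span_base)
  qed
  show ?thesis using assms(1)
  proof (induction rule: mfps.span_induct)
    case base
    show ?case
      by (auto simp: mfps.subspace_def distrib_right mfps_scale_mult_left
          intro: mfps.span_zero mfps.span_add mfps.span_scale)
  next
    case (step f)
    then show ?case using 1 by auto
  qed
qed

text \<open>This is the plethysm identity for \<open>a = 1\<close>: each composition of
  \<open>r\<close> becomes a multiset of blocks with first entry \<open>d\<close>.\<close>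

lemma power_sum_in_h_span:
  assumes "d \<ge> 1" "r \<ge> 1"
  shows "h_pow d r 1 \<in> h_span (d * r)"
  unfolding h_pow_eq_sum_compositions[OF assms(2)]
proof (rule mfps.span_sum)
  fix \<beta> assume "\<beta> \<in> compositions (r * 1)"
  then have \<beta>: "0 \<notin> set \<beta>" "sum_list \<beta> = r" by (auto simp: compositions_def)
  let ?B = "mset (map (Pair d) \<beta>)"
  have "block_weight ?B = d * sum_list \<beta>"
    unfolding block_weight_def by (induction \<beta>) (auto simp: algebra_simps)
  moreover have "\<forall>p\<in>#?B. fst p \<ge> 1 \<and> snd p \<ge> 1"
    using \<beta>(1) assms(1) by (auto simp: Suc_le_eq intro!: gr0I)
  ultimately have "?B \<in> block_msets (d * r)" using \<beta> by (simp add: block_msets_def)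
  moreover have "(\<Prod>b\<leftarrow>\<beta>. h_var d b) = h_blocks ?B"
    unfolding h_blocks_def by (induction \<beta>) auto
  ultimately show "of_int (shat_comp r \<beta>) * (\<Prod>b\<leftarrow>\<beta>. h_var d b) \<in> h_span (d * r)"
    by (auto simp: mfps_scale_of_int[symmetric] intro: mfps.span_scale mfps.span_base)
qed

lemma p_blocks_in_h_span:
  assumes "\<forall>p\<in>#B. fst p \<ge> 1 \<and> snd p \<ge> 1"
  shows "p_blocks B \<in> h_span (block_weight B)"
  using assms
proof (induction B)
  case empty
  have "{#} \<in> block_msets 0" by (simp add: block_msets_def block_weight_def)
  then have "h_blocks {#} \<in> h_span 0" by (intro mfps.span_base) auto
  then show ?case by (simp add: p_blocks_def h_blocks_def block_weight_def)
next
  case (add p B)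
  then have "h_pow (fst p) (snd p) 1 * p_blocks B \<in> h_span (fst p * snd p + block_weight B)"
    by (intro h_span_mult power_sum_in_h_span) auto
  then show ?case by (simp add: p_blocks_add_mset block_weight_def)
qed

text \<open>A dimension count: a finite set whose span contains the independent
  \<open>p_blocks\<close> has at least \<open>card (block_msets n)\<close> elements. For the set of
  the \<open>h_blocks\<close> this forces injectivity; if they were dependent, removing a redundant
  one would leave a spanning set that is too small.\<close>

lemma
  shows independent_h_blocks: "mfps.independent (h_blocks ` block_msets n)"
    and inj_on_h_blocks: "inj_on h_blocks (block_msets n)"
proof -
  let ?S = "block_msets n"
  have bound: "card ?S \<le> card T" if "finite T" "p_blocks ` ?S \<subseteq> mfps.span T" for T
    using mfps.independent_span_bound[OF that(1) independent_p_blocks that(2)]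
    by (simp add: card_image inj_on_p_blocks)
  have sub: "p_blocks ` ?S \<subseteq> h_span n"
    using p_blocks_in_h_span by (auto simp: block_msets_def)
  show "inj_on h_blocks ?S"
    using bound[OF _ sub] card_image_le[OF finite_block_msets, of h_blocks n]
    by (intro eq_card_imp_inj_on) (auto simp: finite_block_msets intro: antisym)
  show "mfps.independent (h_blocks ` ?S)"
  proof
    assume "mfps.dependent (h_blocks ` ?S)"
    then obtain a where a: "a \<in> h_blocks ` ?S" "a \<in> mfps.span (h_blocks ` ?S - {a})"
      by (auto simp: mfps.dependent_def)
    then have "p_blocks ` ?S \<subseteq> mfps.span (h_blocks ` ?S - {a})"
      using sub mfps.span_redundant[OF a(2)] by (simp add: insert_absorb)
    then have "card ?S \<le> card (h_blocks ` ?S - {a})"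
      by (intro bound) (simp add: finite_block_msets)
    also have "\<dots> < card (h_blocks ` ?S)"
      using a(1) by (intro psubset_card_mono) (auto simp: finite_block_msets)
    also have "\<dots> \<le> card ?S" by (rule card_image_le[OF finite_block_msets])
    finally show False by simp
  qed
qed

subsection \<open>Types, block multisets and tabloids\<close>

lemma blocks_eq_sum: "finite (otype_supp \<delta>) \<Longrightarrow> blocks \<delta> = (\<Sum>i\<in>otype_supp \<delta>. image_mset (Pair i) (mset (\<delta> i)))"
  by (simp add: blocks_def block_list_def mset_concat o_def sum_list_distinct_conv_sum_set)

lemma filter_blocks:
  assumes "finite (otype_supp \<delta>)"
  shows "filter_mset (\<lambda>p. fst p = i) (blocks \<delta>) = image_mset (Pair i) (mset (\<delta> i))"
proof -
  have "filter_mset (\<lambda>p. fst p = i) (blocks \<delta>) =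
      (\<Sum>j\<in>otype_supp \<delta>. if j = i then image_mset (Pair i) (mset (\<delta> i)) else {#})"
    unfolding blocks_eq_sum[OF assms] filter_mset_sum
    by (rule sum.cong) (auto simp: filter_mset_image_mset)
  also have "\<dots> = image_mset (Pair i) (mset (\<delta> i))"
    using assms by (auto simp: otype_supp_def)
  finally show ?thesis .
qed

lemma multiset_eq_by_fst:
  assumes "\<And>i. filter_mset (\<lambda>p. fst p = i) B = filter_mset (\<lambda>p. fst p = i) C"
  shows "B = C"
proof (rule multiset_eqI)
  fix p
  have "count B p = count (filter_mset (\<lambda>q. fst q = fst p) B) p" by simp
  then show "count B p = count C p" using assms[of "fst p"] by simp
qed

lemma otype_supp_psort [simp]: "otype_supp (psort \<delta>) = otype_supp \<delta>"
  by (auto simp: otype_supp_def psort_def) (metis mset_sort mset_zero_iff)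

lemma blocks_psort [simp]: "finite (otype_supp \<delta>) \<Longrightarrow> blocks (psort \<delta>) = blocks \<delta>"
  by (rule multiset_eq_by_fst) (simp add: filter_blocks, simp add: psort_def)

lemma h_otimes_eq_h_blocks: "finite (otype_supp \<delta>) \<Longrightarrow> h_otimes \<delta> = h_blocks (blocks \<delta>)"
proof -
  assume fin: "finite (otype_supp \<delta>)"
  have "h_blocks (blocks \<delta>) = (\<Prod>i\<in>otype_supp \<delta>. h_blocks (image_mset (Pair i) (mset (\<delta> i))))"
    unfolding blocks_eq_sum[OF fin] using fin
    by (induction rule: finite_induct) (auto simp: h_blocks_def)
  moreover have "h_blocks (image_mset (Pair i) (mset (\<delta> i))) = (\<Prod>b\<leftarrow>\<delta> i. h_var i b)" for i
    by (simp add: h_blocks_def image_mset.compositionality o_def prod_mset_prod_list flip: mset_map)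
  ultimately show ?thesis by (simp add: h_otimes_def)
qed

lemma block_weight_blocks:
  assumes "finite (otype_supp \<delta>)"
  shows "block_weight (blocks \<delta>) = (\<Sum>i\<in>otype_supp \<delta>. i * sum_list (\<delta> i))"
proof -
  have "block_weight (blocks \<delta>) = (\<Sum>i\<in>otype_supp \<delta>. block_weight (image_mset (Pair i) (mset (\<delta> i))))"
    unfolding blocks_eq_sum[OF assms] using assms
    by (induction rule: finite_induct) (auto simp: block_weight_def)
  moreover have "block_weight (image_mset (Pair i) (mset (\<delta> i))) = i * sum_list (\<delta> i)" for i
    by (simp add: block_weight_def image_mset.compositionality o_def sum_list_const_mult
        sum_mset_sum_list flip: mset_map)
  ultimately show ?thesis by simp
qed

lemma in_blocks_iff: "finite (otype_supp \<delta>) \<Longrightarrow> (i, b) \<in># blocks \<delta> \<longleftrightarrow> b \<in> set (\<delta> i)"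
  by (auto simp: blocks_eq_sum set_mset_sum otype_supp_def intro!: exI[of _ i])

lemma blocks_in_block_msets:
  assumes "\<delta> \<in> OTyp n"
  shows "blocks \<delta> \<in> block_msets n"
proof -
  have fin: "finite (otype_supp \<delta>)" using assms by (simp add: OTyp_def)
  have "i \<ge> 1 \<and> b \<ge> 1" if "(i, b) \<in># blocks \<delta>" for i b
    using that assms unfolding in_blocks_iff[OF fin] OTyp_def
    by (cases "i = 0"; cases "b = 0") auto
  then show ?thesis
    using assms by (auto simp: block_msets_def block_weight_blocks[OF fin] OTyp_def)
qed

text \<open>A multiset of blocks comes from the type that lists, for each \<open>i\<close>, the
  second entries of its blocks at \<open>i\<close> in decreasing order.\<close>

lemma blocks_image_Typ: "blocks ` Typ n = block_msets n"
proof
  show "blocks ` Typ n \<subseteq> block_msets n" using blocks_in_block_msets by (auto simp: Typ_def)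
  show "block_msets n \<subseteq> blocks ` Typ n"
  proof
    fix B assume B: "B \<in> block_msets n"
    define \<tau> where "\<tau> = (\<lambda>i. rev (sorted_list_of_multiset (image_mset snd (filter_mset (\<lambda>p. fst p = i) B))))"
    have "otype_supp \<tau> \<subseteq> fst ` set_mset B"
    proof
      fix i assume "i \<in> otype_supp \<tau>"
      then obtain b where "b \<in> set (\<tau> i)" by (cases "\<tau> i") (auto simp: otype_supp_def)
      then have "(i, b) \<in># B" by (auto simp: \<tau>_def)
      then show "i \<in> fst ` set_mset B" by (metis fst_conv image_eqI)
    qed
    then have fin: "finite (otype_supp \<tau>)" by (rule finite_subset) simp
    have "blocks \<tau> = B"
    proof (rule multiset_eq_by_fst)
      fix i
      have "filter_mset (\<lambda>p. fst p = i) (blocks \<tau>) =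
          image_mset (\<lambda>p. (i, snd p)) (filter_mset (\<lambda>p. fst p = i) B)"
        unfolding filter_blocks[OF fin] by (simp add: \<tau>_def image_mset.compositionality o_def)
      also have "\<dots> = image_mset (\<lambda>p. p) (filter_mset (\<lambda>p. fst p = i) B)"
        by (rule image_mset_cong) auto
      finally show "filter_mset (\<lambda>p. fst p = i) (blocks \<tau>) = filter_mset (\<lambda>p. fst p = i) B" by simp
    qed
    moreover have "\<tau> \<in> Typ n"
    proof -
      have pos: "b \<noteq> 0 \<and> i \<noteq> 0" if "b \<in> set (\<tau> i)" for i b
        using that B by (auto simp: \<tau>_def block_msets_def)
      have "0 \<notin> set (\<tau> i)" for i using pos[of 0 i] by blast
      moreover have "\<tau> 0 = []" using pos[of "hd (\<tau> 0)" 0] by (cases "\<tau> 0") auto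
      moreover have "sorted_wrt (\<ge>) (\<tau> i)" for i
        by (simp add: \<tau>_def sorted_wrt_rev)
      moreover have "(\<Sum>i\<in>otype_supp \<tau>. i * sum_list (\<tau> i)) = n"
        using block_weight_blocks[OF fin] \<open>blocks \<tau> = B\<close> B by (simp add: block_msets_def)
      ultimately show ?thesis using fin by (simp add: Typ_def OTyp_def)
    qed
    ultimately show "B \<in> blocks ` Typ n" by blast
  qed
qed

lemma h_otimes_image_Typ: "h_otimes ` Typ n = h_blocks ` block_msets n"
proof -
  have "h_otimes \<tau> = h_blocks (blocks \<tau>)" if "\<tau> \<in> Typ n" for \<tau>
    using that by (intro h_otimes_eq_h_blocks) (simp add: Typ_def OTyp_def)
  then show ?thesis by (simp add: blocks_image_Typ[symmetric] image_image)
qed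

text \<open>\<open>mfps.representation\<close> is indexed by series, \<open>c\<close> by multisets.
  Independence makes the coefficients unique, and injectivity of \<open>h_blocks\<close> keeps
  different multisets from sharing a basis element.\<close>

lemma h_coeff_expansion:
  assumes "f = (\<Sum>B\<in>block_msets n. mfps_scale (c B) (h_blocks B))" "\<tau> \<in> Typ n"
  shows "h_coeff n f \<tau> = c (blocks \<tau>)"
proof -
  let ?R = "mfps.representation (h_blocks ` block_msets n)"
  have \<tau>: "h_otimes \<tau> = h_blocks (blocks \<tau>)" "blocks \<tau> \<in> block_msets n"
    using assms(2) blocks_image_Typ
    by (auto intro!: h_otimes_eq_h_blocks simp: Typ_def OTyp_def)
  have "?R f = (\<lambda>v. \<Sum>B\<in>block_msets n. ?R (mfps_scale (c B) (h_blocks B)) v)"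
    unfolding assms(1)
    by (rule mfps.representation_sum[OF independent_h_blocks])
       (auto intro: mfps.span_scale mfps.span_base)
  then have "h_coeff n f \<tau> = (\<Sum>B\<in>block_msets n. ?R (mfps_scale (c B) (h_blocks B)) (h_blocks (blocks \<tau>)))"
    by (simp add: h_coeff_def h_otimes_image_Typ \<tau>(1))
  also have "\<dots> = (\<Sum>B\<in>block_msets n. if B = blocks \<tau> then c B else 0)"
  proof (rule sum.cong[OF refl])
    fix B assume B: "B \<in> block_msets n"
    have "?R (mfps_scale (c B) (h_blocks B)) v = c B * (if v = h_blocks B then 1 else 0)" for v
      using B by (subst mfps.representation_scale[OF independent_h_blocks])
        (auto simp: mfps.representation_basis[OF independent_h_blocks] intro: mfps.span_base)
    then show "?R (mfps_scale (c B) (h_blocks B)) (h_blocks (blocks \<tau>)) =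
        (if B = blocks \<tau> then c B else 0)"
      using inj_on_eq_iff[OF inj_on_h_blocks B \<tau>(2)] by auto
  qed
  also have "\<dots> = c (blocks \<tau>)" using \<tau>(2) by (simp add: finite_block_msets)
  finally show ?thesis .
qed

section \<open>Polywrappings and their contents\<close>

definition content :: "polywrap \<Rightarrow> (nat \<times> nat) multiset" where
  "content D = blocks (psort (pocon D))"

lemma OTyp_divD:
  assumes "\<delta> \<in> OTyp_div r n"
  shows "finite (otype_supp \<delta>)" "\<delta> 0 = []" "\<delta> \<in> OTyp n"
  using assms by (auto simp: OTyp_div_def OTyp_def)

lemma finite_OTyp_div:
  assumes "r \<ge> 1"
  shows "finite (OTyp_div r (d * r))"
proof (rule finite_subset)
  let ?L = "\<Union>\<alpha>\<in>area_seqs d. \<Union>i\<in>{1..d}. compositions (r * \<alpha> i)"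
  show "OTyp_div r (d * r) \<subseteq>
      {\<delta>. \<forall>i. (i \<in> {1..d} \<longrightarrow> \<delta> i \<in> ?L) \<and> (i \<notin> {1..d} \<longrightarrow> \<delta> i = [])}"
  proof (rule subsetI, rule CollectI, rule allI, rule conjI; rule impI)
    fix \<delta> i assume \<delta>: "\<delta> \<in> OTyp_div r (d * r)"
    show "\<delta> i \<in> ?L" if "i \<in> {1..d}" using \<delta> that unfolding OTyp_div_iff[OF assms] by blast
    show "\<delta> i = []" if "i \<notin> {1..d}" using \<delta> that unfolding OTyp_div_iff[OF assms] by blast
  qed
  show "finite {\<delta>. \<forall>i. (i \<in> {1..d} \<longrightarrow> \<delta> i \<in> ?L) \<and> (i \<notin> {1..d} \<longrightarrow> \<delta> i = [])}"
    by (rule finite_set_of_finite_funs) (auto simp: finite_area_seqs finite_compositions)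
qed

text \<open>A wrapping has one rectangle for each part of its content, so boundedness is a condition
  on the ordered content.\<close>

lemma bounded_polywrappings_eq:
  "bounded_polywrappings d r = polywrapping r ` {\<delta> \<in> OTyp_div r (d * r). \<forall>k. length (\<delta> k) \<le> r}"
  by (auto simp: bounded_polywrappings_def polywrappings_def polywrapping_def wrapping_def)

lemma finite_bounded_polywrappings: "r \<ge> 1 \<Longrightarrow> finite (bounded_polywrappings d r)"
  by (simp add: bounded_polywrappings_eq finite_OTyp_div)

lemma content_polywrapping:
  assumes "\<delta> \<in> OTyp_div r n" "r \<ge> 1"
  shows "content (polywrapping r \<delta>) = blocks \<delta>"
  using OTyp_divD[OF assms(1)] by (simp add: content_def pocon_polywrapping[OF assms(2)])

text \<open>This is why only bounded polywrappings are summed: the other terms of the block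
  expansion vanish.\<close>

lemma shat_unbounded:
  assumes "finite (otype_supp \<delta>)" "length (\<delta> k) > r"
  shows "shat r \<delta> = 0"
  unfolding shat_def
proof (rule prod_zero[OF assms(1)], rule bexI)
  show "shat_comp r (\<delta> k) = 0" using assms(2) by (simp add: shat_comp_def)
  show "k \<in> otype_supp \<delta>" using assms(2) by (auto simp: otype_supp_def)
qed

text \<open>\<open>pocon\<close> inverts \<open>polywrapping\<close>, so the expansion over ordered
  types carries over to polywrappings without repetition.\<close>

lemma H_block_eq_sum_polywrappings:
  assumes r: "r \<ge> 1"
  shows "H_block d r =
    (\<Sum>D\<in>bounded_polywrappings d r. of_int (psgn_wrap r D) * h_blocks (content D))"
proof -
  let ?O = "OTyp_div r (d * r)"
  have "H_block d r = (\<Sum>\<delta>\<in>?O. of_int (shat r \<delta>) * h_otimes \<delta>)"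
    by (rule H_block_expansion[OF r])
  also have "\<dots> = (\<Sum>\<delta> | \<delta> \<in> ?O \<and> (\<forall>k. length (\<delta> k) \<le> r). of_int (shat r \<delta>) * h_otimes \<delta>)"
  proof (rule sum.mono_neutral_right)
    show "\<forall>\<delta>\<in>?O - {\<delta> \<in> ?O. \<forall>k. length (\<delta> k) \<le> r}. of_int (shat r \<delta>) * h_otimes \<delta> = 0"
      using OTyp_divD(1) shat_unbounded by (fastforce simp: not_le)
  qed (auto simp: finite_OTyp_div[OF r])
  also have "\<dots> = (\<Sum>D\<in>bounded_polywrappings d r. of_int (psgn_wrap r D) * h_blocks (content D))"
    unfolding bounded_polywrappings_eq
  proof (subst sum.reindex)
    show "inj_on (polywrapping r) {\<delta> \<in> ?O. \<forall>k. length (\<delta> k) \<le> r}"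
      by (rule inj_on_inverseI[of _ pocon]) (auto intro: pocon_polywrapping[OF r] OTyp_divD)
    show "(\<Sum>\<delta> | \<delta> \<in> ?O \<and> (\<forall>k. length (\<delta> k) \<le> r). of_int (shat r \<delta>) * h_otimes \<delta>) =
        sum ((\<lambda>D. of_int (psgn_wrap r D) * h_blocks (content D)) \<circ> polywrapping r)
          {\<delta> \<in> ?O. \<forall>k. length (\<delta> k) \<le> r}"
    proof (rule sum.cong[OF refl])
      fix \<delta> assume "\<delta> \<in> {\<delta> \<in> ?O. \<forall>k. length (\<delta> k) \<le> r}"
      then have \<delta>: "\<delta> \<in> ?O" by simp
      show "of_int (shat r \<delta>) * h_otimes \<delta> =
          ((\<lambda>D. of_int (psgn_wrap r D) * h_blocks (content D)) \<circ> polywrapping r) \<delta>"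
        using OTyp_divD[OF \<delta>] content_polywrapping[OF \<delta> r]
        by (simp add: psgn_wrap_def pocon_polywrapping[OF r] h_otimes_eq_h_blocks)
    qed
  qed
  finally show ?thesis .
qed

section \<open>Distributing a product of block expansions\<close>

lemma list_all2_Cons_set:
  "{ys. list_all2 P (x # xs) ys} = (\<lambda>(y, ys). y # ys) ` ({y. P x y} \<times> {ys. list_all2 P xs ys})"
  by (auto simp: list_all2_Cons1)

lemma list_all2_Nil_set: "Collect (list_all2 P []) = {[]}"
  by auto

lemma finite_list_all2:
  "\<forall>x\<in>set xs. finite {y. P x y} \<Longrightarrow> finite {ys. list_all2 P xs ys}"
  by (induction xs) (auto simp: list_all2_Cons_set list_all2_Nil_set)

text \<open>Distributivity in the \<open>list_all2\<close> form of \<open>tabloids\<close>: a term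
  of the expanded product is a list of choices, one per factor.\<close>

lemma prod_list_sum_list_all2:
  fixes f :: "'a \<Rightarrow> 'b \<Rightarrow> 'c :: comm_semiring_1"
  assumes "\<forall>x\<in>set xs. finite {y. P x y}"
  shows "(\<Prod>x\<leftarrow>xs. \<Sum>y | P x y. f x y) = (\<Sum>ys | list_all2 P xs ys. \<Prod>(x, y)\<leftarrow>zip xs ys. f x y)"
  using assms
proof (induction xs)
  case (Cons x xs)
  have "(\<Prod>x\<leftarrow>x # xs. \<Sum>y | P x y. f x y) =
      (\<Sum>y | P x y. f x y) * (\<Sum>ys | list_all2 P xs ys. \<Prod>(x, y)\<leftarrow>zip xs ys. f x y)"
    using Cons by simp
  also have "\<dots> = (\<Sum>(y, ys)\<in>{y. P x y} \<times> {ys. list_all2 P xs ys}.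
      f x y * (\<Prod>(x, y)\<leftarrow>zip xs ys. f x y))"
    by (simp add: sum_product sum.cartesian_product)
  also have "\<dots> = (\<Sum>ys | list_all2 P (x # xs) ys. \<Prod>(x, y)\<leftarrow>zip (x # xs) ys. f x y)"
    unfolding list_all2_Cons_set
    by (subst sum.reindex) (auto simp: inj_on_def case_prod_unfold intro!: sum.cong)
  finally show ?case .
qed (simp add: list_all2_Nil_set)

lemma content_in_block_msets:
  assumes "D \<in> bounded_polywrappings d r" "r \<ge> 1"
  shows "content D \<in> block_msets (d * r)"
  using assms(1) unfolding bounded_polywrappings_eq
  by (auto simp: content_polywrapping[OF _ assms(2)] intro!: blocks_in_block_msets elim: OTyp_divD(3))

theorem theorem62:
  fixes n :: nat and \<sigma> \<tau> :: "nat \<Rightarrow> nat list"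
  assumes "n \<ge> 1" and "\<sigma> \<in> Typ n" and "\<tau> \<in> Typ n"
  shows "h_coeff n (H_type \<sigma>) \<tau> = of_int (\<Sum>T\<in>tabloids \<sigma> \<tau>. psgn \<sigma> T)"
proof -
  let ?P = "\<lambda>(d, r) D. D \<in> bounded_polywrappings d r"
  let ?bl = "block_list \<sigma>"
  let ?A = "{T. list_all2 ?P ?bl T}"
  let ?cont = "\<lambda>T. \<Sum>D\<leftarrow>T. content D"
  have \<sigma>: "mset ?bl \<in> block_msets n"
    using blocks_in_block_msets[of \<sigma> n] assms(2) by (simp add: Typ_def blocks_def)
  then have r: "r \<ge> 1" if "(d, r) \<in> set ?bl" for d r using that by (auto simp: block_msets_def)
  then have fin: "finite {D. ?P x D}" if "x \<in> set ?bl" for x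
    using that finite_bounded_polywrappings by (cases x) auto
  then have finA: "finite ?A" by (intro finite_list_all2) auto
  \<comment> \<open>Each block is expanded on its own; multiplying out then picks one bounded
    polywrapping per block, that is, a tabloid of shape \<open>\<sigma>\<close> with arbitrary
    content.\<close>
  have "H_type \<sigma> = (\<Prod>x\<leftarrow>?bl. \<Sum>D | ?P x D. of_int (psgn_wrap (snd x) D) * h_blocks (content D))"
    unfolding H_type_def
    by (intro arg_cong[of _ _ prod_list] map_cong refl) (use H_block_eq_sum_polywrappings[OF r] in auto)
  also have "\<dots> = (\<Sum>T\<in>?A. \<Prod>(x, D)\<leftarrow>zip ?bl T. of_int (psgn_wrap (snd x) D) * h_blocks (content D))"
    by (rule prod_list_sum_list_all2) (use fin in auto)
  also have "\<dots> = (\<Sum>T\<in>?A. of_int (psgn \<sigma> T) * h_blocks (?cont T))"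
  proof (rule sum.cong[OF refl])
    fix T assume "T \<in> ?A"
    then have len: "length ?bl = length T" by (auto dest: list_all2_lengthD)
    have "(\<Prod>(x, D)\<leftarrow>zip bl T. of_int (psgn_wrap (snd x) D) * h_blocks (content D)) =
        of_int (\<Prod>((d, r), D)\<leftarrow>zip bl T. psgn_wrap r D) * h_blocks (?cont T)"
      if "length bl = length T" for bl :: "(nat \<times> nat) list" and T
      using that
      by (induction bl T rule: list_induct2) (auto simp: h_blocks_def case_prod_unfold)
    from this[OF len] show "(\<Prod>(x, D)\<leftarrow>zip ?bl T. of_int (psgn_wrap (snd x) D) * h_blocks (content D)) =
        of_int (psgn \<sigma> T) * h_blocks (?cont T)"
      by (simp add: psgn_def)
  qed
  \<comment> \<open>Tabloids of equal content contribute to the same basis element, so they are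
    collected.\<close>
  also have "\<dots> = (\<Sum>B\<in>block_msets n. \<Sum>T | T \<in> ?A \<and> ?cont T = B. of_int (psgn \<sigma> T) * h_blocks (?cont T))"
  proof (rule sum.group[OF finA finite_block_msets, symmetric])
    \<comment> \<open>The claim is stated for lists with entries from \<open>?bl\<close>, so that
      the induction can pass to tails while \<open>r \<ge> 1\<close> stays available.\<close>
    have cont: "?cont T \<in> block_msets (block_weight (mset bl))"
      if "list_all2 ?P bl T" "set bl \<subseteq> set ?bl" for bl T
      using that
    proof (induction rule: list_all2_induct)
      case Nil
      show ?case by (simp add: block_msets_def block_weight_def)
    next
      case (Cons x bl D T)
      then have "content D \<in> block_msets (fst x * snd x)"
        using content_in_block_msets[OF _ r[of "fst x" "snd x"]] by (simp add: case_prod_unfold)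
      moreover have "?cont T \<in> block_msets (block_weight (mset bl))" using Cons by simp
      ultimately have "content D + ?cont T \<in> block_msets (fst x * snd x + block_weight (mset bl))"
        by (rule block_msets_union)
      then show ?case by (simp add: block_weight_def)
    qed
    have "block_weight (mset ?bl) = n" using \<sigma> by (simp add: block_msets_def)
    then show "?cont ` ?A \<subseteq> block_msets n" using cont[of ?bl] by auto
  qed
  also have "\<dots> = (\<Sum>B\<in>block_msets n.
      mfps_scale (of_int (\<Sum>T | T \<in> ?A \<and> ?cont T = B. psgn \<sigma> T)) (h_blocks B))"
  proof (rule sum.cong[OF refl])
    fix B
    have "(\<Sum>T | T \<in> ?A \<and> ?cont T = B. of_int (psgn \<sigma> T) * h_blocks (?cont T)) =
        (\<Sum>T | T \<in> ?A \<and> ?cont T = B. of_int (psgn \<sigma> T) * h_blocks B)"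
      by (rule sum.cong) auto
    then show "(\<Sum>T | T \<in> ?A \<and> ?cont T = B. of_int (psgn \<sigma> T) * h_blocks (?cont T)) =
        mfps_scale (of_int (\<Sum>T | T \<in> ?A \<and> ?cont T = B. psgn \<sigma> T)) (h_blocks B)"
      unfolding mfps_scale_of_int by (simp only: of_int_sum sum_distrib_right)
  qed
  finally have "h_coeff n (H_type \<sigma>) \<tau> = of_int (\<Sum>T | T \<in> ?A \<and> ?cont T = blocks \<tau>. psgn \<sigma> T)"
    using assms(3) by (rule h_coeff_expansion)
  moreover have "{T. T \<in> ?A \<and> ?cont T = blocks \<tau>} = tabloids \<sigma> \<tau>"
    by (auto simp: tabloids_def content_def)
  ultimately show ?thesis by simp
qed

end
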